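(* Let $(\Gamma,\mathcal H)$, $\mathcal H=(r_0,d_0,\epsilon,m,h)$, be a Hurwitz tree and $s$ a vertex of $\Gamma$ of valence $\ge3$. (a) Suppose that $s$ is multiplicative and that there is a unique edge $a_0$ with origin $s$ such that $m(a_0)\ne0$. Put $m:=-m(a_0)$, $I_s:=\mathrm{Ar}(s)\setminus\{a_0\}$ and $\underline h:=(h(a))_{a\in I_s}$. If there exists a maximal $\underline h$-adapted partition $P$ of $I_s$ with $\mathrm{card}\,P\le[\frac mp]+1$, then $s$ is realizable. (b) Suppose that $s$ is additive and that there is a unique edge $a_0$ with origin $s$ such that $m(a_0)<0$. Put $m:=-m(a_0)$, let $I_s$ be the disjoint union of $I'_s:=\mathrm{Ar}(s)\setminus\{a_0\}$ and a finite set with $m+1-\mathrm{card}(I'_s)$ elements, and let $\underline e=(e_i)_{i\in I_s}$ be the family defined by $e_i:=m(i)$ if $i\in I'_s$ and $e_i:=-1$ otherwise (in $\mathbb F_p$). If there exists a maximal $\underline e$-adapted partition $P$ of $I_s$ with $\mathrm{card}\,P\le[\frac mp]+1$, then $s$ is realizable.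
   Context: **Setting.** $R$ is a complete discrete valuation ring with fraction field $K$ of characteristic $0$ and algebraically closed residue field $k$ of characteristic $p>0$; $v_K$ is the normalized valuation of $K$; $K$ contains a primitive $p$-th root of unity. **Adapted partitions.** Let $I$ be a finite nonempty set and $\underline e=(e_i)_{i\in I}$ a family of elements of $\mathbb F_p$. A partition $P$ of $I$ is $\underline e$-adapted if $\sum_{i\in J}e_i=0$ in $\mathbb F_p$ for every $J\in P$. Partitions are ordered by: $P<P'$ if every $J'\in P'$ is contained in some $J\in P$ (i.e. $P'$ is finer). A maximal $\underline e$-adapted partition is a maximal element, for this order, of the set of $\underline e$-adapted partitions. $[x]$ is the integer part. **Trees.** $\Gamma$ is a finite connected tree (in Serre's sense): each edge $a$ has an origin $o(a)$, a terminal vertex $t(a)$ and an opposite edge $\bar a$. Given a vertex $r_0$ (the root), $\Gamma$ is oriented away from $r_0$; an edge is positive if it points away from the root. Vertices are ordered by: $s_1\le s_2$ iff there is a chain of positive edges from $s_1$ to $s_2$; "maximal vertex" refers to this order. $\mathrm{Ar}(\Gamma)$ is the set of edges, $\mathrm{Ar}(s)$ the set of edges with origin $s$, the valence of $s$ is $|\mathrm{Ar}(s)|$. $\Gamma_s$ is the chain from $r_0$ to $s$, and $\mathrm{Ar}^+(\Gamma_s)$ the set of its positive edges. **Hurwitz trees.** A Hurwitz datum on $\Gamma$ is $\mathcal H=(r_0,d_0,\epsilon,m,h)$ with $r_0$ a vertex (root), $d_0$ an integer divisible by $p-1$ with $0\le d_0\le v_K(p)$, and maps $\epsilon:\mathrm{Ar}(\Gamma)\to\mathbb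 N$ with $\epsilon(\bar a)=\epsilon(a)$, $m:\mathrm{Ar}(\Gamma)\to\mathbb Z$, $h:\mathrm{Ar}(\Gamma)\to\mathbb Z/p\mathbb Z$, such that, with $d(s):=d_0+(p-1)\sum_{a\in \mathrm{Ar}^+(\Gamma_s)}m(a)\epsilon(a)$: (H1) $m(\bar a)=-m(a)$, $h(\bar a)=-h(a)$ for all edges $a$; (H2) $m(a)=0$ iff $h(a)\ne0$; if $m(a)\neq0$ then $m(a)$ is prime to $p$; (H3) every vertex $s$ of valence $>1$ has valence $\ge3$, and $\sum_{a\in \mathrm{Ar}(s)}(m(a)+1)=2$, $\sum_{a\in \mathrm{Ar}(s)}h(a)=0$ in $\mathbb Z/p\mathbb Z$; (H4) if $a$ is a positive edge with $\epsilon(a)=0$, its terminal vertex is maximal; if moreover $m(a)=0$, $a$ is called a leaf; (H5) $0\le d(s)\le v_K(p)$ for every vertex $s$; $s$ is called multiplicative if $d(s)=v_K(p)$, additive if $0<d(s)<v_K(p)$, étale if $d(s)=0$; (H6) the origin of a leaf is multiplicative; (H7) if $s$ is additive or étale then $h(a)=0$ for every edge $a$ with origin $s$. Then $(\Gamma,\mathcal H)$ is a Hurwitz tree. **Realizable vertices.** Let $s$ be a vertex of valence $\ge3$. If $s$ is multiplicative, it is realizable if there are $\bar u_s\in k(t)$ and an injection $j_s:\mathrm{Ar}(s)\to\mathbb P^1(k)$ such that $\frac{d\bar u_s}{\bar u_s}$ has residue $h(a)$ at $j_s(a)$ for each $a\in \mathrm{Ar}(s)$ and $\mathrm{div}\bigl(\frac{d\bar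 u_s}{\bar u_s}\bigr)=-\sum_{a\in \mathrm{Ar}(s)}(m(a)+1)[j_s(a)]$. If $s$ is additive, it is realizable if there are $\bar u_s\in k(t)$ and an injection $j_s:\mathrm{Ar}(s)\to\mathbb P^1(k)$ with $\mathrm{div}(d\bar u_s)=-\sum_{a\in \mathrm{Ar}(s)}(m(a)+1)[j_s(a)]$. *)

theory Defs
  imports
    "Berlekamp_Zassenhaus.Finite_Field"
    "HOL-Computational_Algebra.Fraction_Field"
    "HOL-Computational_Algebra.Formal_Laurent_Series"
    "HOL-Computational_Algebra.Polynomial_FPS"
    "HOL-Library.Disjoint_Sets"
begin

section \<open>Complete discrete valuation rings\<close>

text \<open>
  The ring is given inside its fraction field as the valuation ring
  \<open>val_ideal v 0\<close> of the normalized valuation \<open>v\<close>. The value \<open>v 0\<close> is irrelevant: zero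
  (whose valuation is infinite) is treated separately throughout.
\<close>

definition val_ideal :: "('K::field \<Rightarrow> int) \<Rightarrow> int \<Rightarrow> 'K set" where
  "val_ideal v n = {x. x = 0 \<or> n \<le> v x}"

text \<open>
  The residue field is presented as a field \<open>'k\<close> with a surjective ring homomorphism
  \<open>res\<close> from the valuation ring whose kernel is the maximal ideal; \<open>res\<close> is
  unconstrained outside the valuation ring.
\<close>

locale complete_dvr =
  fixes v :: "'K::field \<Rightarrow> int" and res :: "'K \<Rightarrow> 'k::field"
  assumes v_mult: "x \<noteq> 0 \<Longrightarrow> y \<noteq> 0 \<Longrightarrow> v (x * y) = v x + v y"
    and v_add: "x \<noteq> 0 \<Longrightarrow> y \<noteq> 0 \<Longrightarrow> x + y \<noteq> 0 \<Longrightarrow> min (v x) (v y) \<le> v (x + y)"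
    and v_normalized: "\<exists>x. x \<noteq> 0 \<and> v x = 1"
    and complete:
      "\<And>X :: nat \<Rightarrow> 'K. \<lbrakk>range X \<subseteq> val_ideal v 0; \<forall>N. \<exists>n\<^sub>0. \<forall>i\<ge>n\<^sub>0. \<forall>j\<ge>n\<^sub>0. X i - X j \<in> val_ideal v N\<rbrakk>
        \<Longrightarrow> \<exists>L\<in>val_ideal v 0. \<forall>N. \<exists>n\<^sub>0. \<forall>i\<ge>n\<^sub>0. X i - L \<in> val_ideal v N"
    and res_one: "res 1 = 1"
    and res_add: "x \<in> val_ideal v 0 \<Longrightarrow> y \<in> val_ideal v 0 \<Longrightarrow> res (x + y) = res x + res y"
    and res_mult: "x \<in> val_ideal v 0 \<Longrightarrow> y \<in> val_ideal v 0 \<Longrightarrow> res (x * y) = res x * res y"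
    and res_surj: "res ` val_ideal v 0 = UNIV"
    and res_kernel: "x \<in> val_ideal v 0 \<Longrightarrow> res x = 0 \<longleftrightarrow> x \<in> val_ideal v 1"

definition primitive_root_of_unity :: "nat \<Rightarrow> 'K::field \<Rightarrow> bool" where
  "primitive_root_of_unity n \<zeta> \<longleftrightarrow> 0 < n \<and> \<zeta> ^ n = 1 \<and> (\<forall>j. 0 < j \<and> j < n \<longrightarrow> \<zeta> ^ j \<noteq> 1)"


section \<open>Adapted partitions\<close>

definition adapted_partition :: "'i set \<Rightarrow> ('i \<Rightarrow> 'p::prime_card mod_ring) \<Rightarrow> 'i set set \<Rightarrow> bool" where
  "adapted_partition I e P \<longleftrightarrow> partition_on I P \<and> (\<forall>J\<in>P. (\<Sum>i\<in>J. e i) = 0)"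

text \<open>\<open>refines I Q P\<close> says that \<open>Q\<close> is finer than \<open>P\<close>; finer partitions are the larger ones.\<close>

definition maximal_adapted_partition ::
  "'i set \<Rightarrow> ('i \<Rightarrow> 'p::prime_card mod_ring) \<Rightarrow> 'i set set \<Rightarrow> bool" where
  "maximal_adapted_partition I e P \<longleftrightarrow> adapted_partition I e P \<and>
     (\<forall>Q. adapted_partition I e Q \<and> refines I Q P \<longrightarrow> Q = P)"


section \<open>Graphs and trees in the sense of Serre\<close>

record ('v, 'e) serre_graph =
  verts :: "'v set"
  arcs :: "'e set"
  origin :: "'e \<Rightarrow> 'v"
  terminus :: "'e \<Rightarrow> 'v"
  opposite :: "'e \<Rightarrow> 'e"

definition is_serre_graph :: "('v, 'e) serre_graph \<Rightarrow> bool" where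
  "is_serre_graph \<Gamma> \<longleftrightarrow>
     (\<forall>a\<in>arcs \<Gamma>. origin \<Gamma> a \<in> verts \<Gamma> \<and> terminus \<Gamma> a \<in> verts \<Gamma> \<and> opposite \<Gamma> a \<in> arcs \<Gamma> \<and>
        opposite \<Gamma> a \<noteq> a \<and> opposite \<Gamma> (opposite \<Gamma> a) = a \<and> origin \<Gamma> (opposite \<Gamma> a) = terminus \<Gamma> a)"

fun graph_path :: "('v, 'e) serre_graph \<Rightarrow> 'v \<Rightarrow> 'e list \<Rightarrow> 'v \<Rightarrow> bool" where
  "graph_path \<Gamma> s [] s' \<longleftrightarrow> s \<in> verts \<Gamma> \<and> s' = s"
| "graph_path \<Gamma> s (a # as) s' \<longleftrightarrow> a \<in> arcs \<Gamma> \<and> origin \<Gamma> a = s \<and> graph_path \<Gamma> (terminus \<Gamma> a) as s'"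

definition no_backtracking :: "('v, 'e) serre_graph \<Rightarrow> 'e list \<Rightarrow> bool" where
  "no_backtracking \<Gamma> as \<longleftrightarrow> (\<forall>i. Suc i < length as \<longrightarrow> as ! Suc i \<noteq> opposite \<Gamma> (as ! i))"

definition connected_graph :: "('v, 'e) serre_graph \<Rightarrow> bool" where
  "connected_graph \<Gamma> \<longleftrightarrow> (\<forall>s\<in>verts \<Gamma>. \<forall>s'\<in>verts \<Gamma>. \<exists>as. graph_path \<Gamma> s as s')"

text \<open>Circuits may have length one (loops) or two (double edges).\<close>

definition circuit :: "('v, 'e) serre_graph \<Rightarrow> 'e list \<Rightarrow> bool" where
  "circuit \<Gamma> as \<longleftrightarrow> as \<noteq> [] \<and> (\<exists>s. graph_path \<Gamma> s as s) \<and> no_backtracking \<Gamma> as \<and>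
     distinct (map (terminus \<Gamma>) as)"

definition finite_tree :: "('v, 'e) serre_graph \<Rightarrow> bool" where
  "finite_tree \<Gamma> \<longleftrightarrow> is_serre_graph \<Gamma> \<and> finite (verts \<Gamma>) \<and> finite (arcs \<Gamma>) \<and> verts \<Gamma> \<noteq> {} \<and>
     connected_graph \<Gamma> \<and> (\<nexists>as. circuit \<Gamma> as)"

definition arcs_from :: "('v, 'e) serre_graph \<Rightarrow> 'v \<Rightarrow> 'e set" where
  "arcs_from \<Gamma> s = {a \<in> arcs \<Gamma>. origin \<Gamma> a = s}"

definition valence :: "('v, 'e) serre_graph \<Rightarrow> 'v \<Rightarrow> nat" where
  "valence \<Gamma> s = card (arcs_from \<Gamma> s)"

text \<open>In a tree there is exactly one path without backtracking between two vertices.\<close>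

definition chain :: "('v, 'e) serre_graph \<Rightarrow> 'v \<Rightarrow> 'v \<Rightarrow> 'e list" where
  "chain \<Gamma> s s' = (THE as. graph_path \<Gamma> s as s' \<and> no_backtracking \<Gamma> as)"

definition positive_arc :: "('v, 'e) serre_graph \<Rightarrow> 'v \<Rightarrow> 'e \<Rightarrow> bool" where
  "positive_arc \<Gamma> r a \<longleftrightarrow> a \<in> arcs \<Gamma> \<and>
     chain \<Gamma> r (terminus \<Gamma> a) = chain \<Gamma> r (origin \<Gamma> a) @ [a]"

definition vertex_le :: "('v, 'e) serre_graph \<Rightarrow> 'v \<Rightarrow> 'v \<Rightarrow> 'v \<Rightarrow> bool" where
  "vertex_le \<Gamma> r s s' \<longleftrightarrow> (\<exists>as. graph_path \<Gamma> s as s' \<and> (\<forall>a\<in>set as. positive_arc \<Gamma> r a))"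

definition maximal_vertex :: "('v, 'e) serre_graph \<Rightarrow> 'v \<Rightarrow> 'v \<Rightarrow> bool" where
  "maximal_vertex \<Gamma> r s \<longleftrightarrow> s \<in> verts \<Gamma> \<and> (\<forall>s'\<in>verts \<Gamma>. vertex_le \<Gamma> r s s' \<longrightarrow> s' = s)"

text \<open>The subgraph \<open>chain \<Gamma> r s\<close> contains, with each edge, the opposite one.\<close>

definition positive_chain_arcs :: "('v, 'e) serre_graph \<Rightarrow> 'v \<Rightarrow> 'v \<Rightarrow> 'e set" where
  "positive_chain_arcs \<Gamma> r s =
     {a \<in> set (chain \<Gamma> r s) \<union> opposite \<Gamma> ` set (chain \<Gamma> r s). positive_arc \<Gamma> r a}"


section \<open>Hurwitz trees\<close>

record ('v, 'e, 'p) hurwitz_datum =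
  ht_root :: 'v
  ht_d :: int
  ht_eps :: "'e \<Rightarrow> nat"
  ht_m :: "'e \<Rightarrow> int"
  ht_h :: "'e \<Rightarrow> 'p mod_ring"

definition vertex_d :: "('v, 'e) serre_graph \<Rightarrow> ('v, 'e, 'p::prime_card) hurwitz_datum \<Rightarrow> 'v \<Rightarrow> int" where
  "vertex_d \<Gamma> H s = ht_d H + (int CARD('p) - 1) *
     (\<Sum>a\<in>positive_chain_arcs \<Gamma> (ht_root H) s. ht_m H a * int (ht_eps H a))"

text \<open>The argument \<open>vp\<close> stands for the normalized valuation of the prime \<open>CARD('p)\<close>.\<close>

definition multiplicative_vertex ::
  "int \<Rightarrow> ('v, 'e) serre_graph \<Rightarrow> ('v, 'e, 'p::prime_card) hurwitz_datum \<Rightarrow> 'v \<Rightarrow> bool" where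
  "multiplicative_vertex vp \<Gamma> H s \<longleftrightarrow> vertex_d \<Gamma> H s = vp"

definition additive_vertex ::
  "int \<Rightarrow> ('v, 'e) serre_graph \<Rightarrow> ('v, 'e, 'p::prime_card) hurwitz_datum \<Rightarrow> 'v \<Rightarrow> bool" where
  "additive_vertex vp \<Gamma> H s \<longleftrightarrow> 0 < vertex_d \<Gamma> H s \<and> vertex_d \<Gamma> H s < vp"

definition etale_vertex :: "('v, 'e) serre_graph \<Rightarrow> ('v, 'e, 'p::prime_card) hurwitz_datum \<Rightarrow> 'v \<Rightarrow> bool" where
  "etale_vertex \<Gamma> H s \<longleftrightarrow> vertex_d \<Gamma> H s = 0"

definition leaf :: "('v, 'e) serre_graph \<Rightarrow> ('v, 'e, 'p::prime_card) hurwitz_datum \<Rightarrow> 'e \<Rightarrow> bool" where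
  "leaf \<Gamma> H a \<longleftrightarrow> positive_arc \<Gamma> (ht_root H) a \<and> ht_eps H a = 0 \<and> ht_m H a = 0"

locale hurwitz_tree =
  fixes vp :: int
    and \<Gamma> :: "('v, 'e) serre_graph"
    and H :: "('v, 'e, 'p::prime_card) hurwitz_datum"
  assumes tree: "finite_tree \<Gamma>"
    and root: "ht_root H \<in> verts \<Gamma>"
    and d_root: "(int CARD('p) - 1) dvd ht_d H" "0 \<le> ht_d H" "ht_d H \<le> vp"
    and eps_opposite: "a \<in> arcs \<Gamma> \<Longrightarrow> ht_eps H (opposite \<Gamma> a) = ht_eps H a"
    and H1: "a \<in> arcs \<Gamma> \<Longrightarrow> ht_m H (opposite \<Gamma> a) = - ht_m H a"
      "a \<in> arcs \<Gamma> \<Longrightarrow> ht_h H (opposite \<Gamma> a) = - ht_h H a"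
    and H2: "a \<in> arcs \<Gamma> \<Longrightarrow> ht_m H a = 0 \<longleftrightarrow> ht_h H a \<noteq> 0"
      "a \<in> arcs \<Gamma> \<Longrightarrow> ht_m H a \<noteq> 0 \<Longrightarrow> coprime (ht_m H a) (int CARD('p))"
    and H3: "s \<in> verts \<Gamma> \<Longrightarrow> 1 < valence \<Gamma> s \<Longrightarrow> 3 \<le> valence \<Gamma> s"
      "s \<in> verts \<Gamma> \<Longrightarrow> 1 < valence \<Gamma> s \<Longrightarrow> (\<Sum>a\<in>arcs_from \<Gamma> s. ht_m H a + 1) = 2"
      "s \<in> verts \<Gamma> \<Longrightarrow> 1 < valence \<Gamma> s \<Longrightarrow> (\<Sum>a\<in>arcs_from \<Gamma> s. ht_h H a) = 0"
    and H4: "positive_arc \<Gamma> (ht_root H) a \<Longrightarrow> ht_eps H a = 0 \<Longrightarrow>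
      maximal_vertex \<Gamma> (ht_root H) (terminus \<Gamma> a)"
    and H5: "s \<in> verts \<Gamma> \<Longrightarrow> 0 \<le> vertex_d \<Gamma> H s" "s \<in> verts \<Gamma> \<Longrightarrow> vertex_d \<Gamma> H s \<le> vp"
    and H6: "leaf \<Gamma> H a \<Longrightarrow> multiplicative_vertex vp \<Gamma> H (origin \<Gamma> a)"
    and H7: "s \<in> verts \<Gamma> \<Longrightarrow> additive_vertex vp \<Gamma> H s \<or> etale_vertex \<Gamma> H s \<Longrightarrow>
      a \<in> arcs_from \<Gamma> s \<Longrightarrow> ht_h H a = 0"


section \<open>Rational functions and differential forms on the projective line\<close>

datatype 'k proj_line = Finite_Point 'k | Infinity_Point

text \<open>
  The image of the coordinate \<open>t\<close> in the completed local field at a point, identified with the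
  field of Laurent series through the local parameter \<open>t - x\<close> at a finite point \<open>x\<close> and \<open>1 / t\<close>
  at infinity.
\<close>

primrec coord_at :: "'k::field proj_line \<Rightarrow> 'k fls" where
  "coord_at (Finite_Point x) = fls_const x + fls_X"
| "coord_at Infinity_Point = fls_X_inv"

definition poly_at :: "'k::field proj_line \<Rightarrow> 'k poly \<Rightarrow> 'k fls" where
  "poly_at x p = poly (map_poly fls_const p) (coord_at x)"

lemma poly_at_0 [simp]: "poly_at x 0 = 0"
  by (simp add: poly_at_def)

lemma poly_at_pCons: "poly_at x (pCons c p) = fls_const c + coord_at x * poly_at x p"
  by (simp add: poly_at_def Polynomial.map_poly_pCons)

lemma poly_at_add: "poly_at x (p + q) = poly_at x p + poly_at x q"
proof (induction p q rule: poly_induct2)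
  case (pCons a p b q)
  then show ?case
    by (simp add: poly_at_pCons fls_plus_const algebra_simps)
qed simp

lemma poly_at_smult: "poly_at x (smult c p) = fls_const c * poly_at x p"
  by (induction p) (simp_all add: poly_at_pCons fls_const_mult_const algebra_simps)

lemma poly_at_mult: "poly_at x (p * q) = poly_at x p * poly_at x q"
proof (induction p)
  case (pCons a p)
  then show ?case
    by (simp add: poly_at_pCons poly_at_add poly_at_smult algebra_simps)
qed simp

lemma poly_at_eq_0_iff [simp]: "poly_at x p = 0 \<longleftrightarrow> p = 0"
proof
  assume eq: "poly_at x p = 0"
  show "p = 0"
  proof (cases x)
    case (Finite_Point c)
    have "poly_at x p = fps_to_fls (fps_of_poly (pcompose p [:c, 1:]))"
    proof (induction p)
      case (pCons a p)
      have "fps_to_fls (fps_of_poly [:c, 1:]) = coord_at x"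
        by (simp add: Finite_Point fps_of_poly_pCons fls_plus_const fps_to_fls_plus fps_X_to_fls)
      moreover have "fps_of_poly (pcompose (pCons a p) [:c, 1:]) =
          fps_of_poly [:a:] + fps_of_poly [:c, 1:] * fps_of_poly (pcompose p [:c, 1:])"
        by (simp only: pcompose_pCons fps_of_poly_add fps_of_poly_mult)
      ultimately show ?case
        by (simp only: poly_at_pCons pCons fps_to_fls_plus fls_times_fps_to_fls)
           (simp add: fps_of_poly_const fps_const_to_fls)
    qed simp
    with eq have "pcompose p [:c, 1:] = 0"
      by simp
    then show ?thesis
      using pcompose_eq_0[of p "[:c, 1:]"] by simp
  next
    case Infinity_Point
    have "fls_nth (poly_at x p) (- int n) = coeff p n" for n
    proof (induction p arbitrary: n)
      case (pCons a p)
      show ?case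
      proof (cases n)
        case 0
        have "0 < i \<Longrightarrow> fls_nth (poly_at x q) i = 0" for q i
          by (induction q arbitrary: i)
             (simp_all add: poly_at_pCons Infinity_Point fls_X_inv_times_conv_shift)
        then show ?thesis
          using 0 by (simp add: poly_at_pCons Infinity_Point fls_X_inv_times_conv_shift)
      next
        case (Suc k)
        then show ?thesis
          using pCons.IH[of k] by (simp add: poly_at_pCons Infinity_Point fls_X_inv_times_conv_shift)
      qed
    qed simp
    with eq show ?thesis
      by (metis fls_zero_nth leading_coeff_0_iff)
  qed
qed simp

definition fract_at :: "'k::field proj_line \<Rightarrow> 'k poly fract \<Rightarrow> 'k fls" where
  "fract_at x f = (THE F. \<exists>p q. q \<noteq> 0 \<and> f = Fract p q \<and> F = poly_at x p / poly_at x q)"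

lemma fract_at_Fract:
  assumes "q \<noteq> 0"
  shows "fract_at x (Fract p q) = poly_at x p / poly_at x q"
  unfolding fract_at_def
proof (rule the_equality)
  fix F
  assume "\<exists>p' q'. q' \<noteq> 0 \<and> Fract p q = Fract p' q' \<and> F = poly_at x p' / poly_at x q'"
  then obtain p' q' where *: "q' \<noteq> 0" "Fract p q = Fract p' q'" "F = poly_at x p' / poly_at x q'"
    by blast
  with assms have "p * q' = p' * q"
    by (simp add: eq_fract)
  then have "poly_at x p * poly_at x q' = poly_at x p' * poly_at x q"
    by (simp flip: poly_at_mult)
  with * assms show "F = poly_at x p / poly_at x q"
    by (simp add: frac_eq_eq)
qed (use assms in blast)

text \<open>The derivation \<open>d/dt\<close> on the field of rational functions.\<close>

definition fract_deriv :: "'k::field poly fract \<Rightarrow> 'k poly fract" where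
  "fract_deriv f =
     (THE g. \<exists>p q. q \<noteq> 0 \<and> f = Fract p q \<and> g = Fract (pderiv p * q - p * pderiv q) (q * q))"

lemma fract_deriv_Fract:
  assumes "q \<noteq> 0"
  shows "fract_deriv (Fract p q) = Fract (pderiv p * q - p * pderiv q) (q * q)"
  unfolding fract_deriv_def
proof (rule the_equality)
  fix g
  assume "\<exists>r s. s \<noteq> 0 \<and> Fract p q = Fract r s \<and> g = Fract (pderiv r * s - r * pderiv s) (s * s)"
  then obtain r s where *: "s \<noteq> 0" "Fract p q = Fract r s"
      "g = Fract (pderiv r * s - r * pderiv s) (s * s)"
    by blast
  with assms have eq: "p * s = r * q"
    by (simp add: eq_fract)
  then have "pderiv (p * s) = pderiv (r * q)"
    by simp
  then have "pderiv p * s + p * pderiv s = pderiv r * q + r * pderiv q"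
    by (simp add: pderiv_mult algebra_simps)
  then have rq: "pderiv r * q = pderiv p * s + p * pderiv s - r * pderiv q"
    by (simp add: algebra_simps)
  have "(pderiv r * s - r * pderiv s) * (q * q) = (pderiv r * q) * (q * s) - (r * q) * (q * pderiv s)"
    by (simp add: algebra_simps)
  also have "\<dots> = (pderiv p * s + p * pderiv s - r * pderiv q) * (q * s) - (p * s) * (q * pderiv s)"
    by (simp only: rq eq)
  also have "\<dots> = pderiv p * q * (s * s) - (r * q) * (s * pderiv q)"
    by (simp add: algebra_simps)
  also have "\<dots> = pderiv p * q * (s * s) - (p * s) * (s * pderiv q)"
    by (simp only: eq)
  also have "\<dots> = (pderiv p * q - p * pderiv q) * (s * s)"
    by (simp add: algebra_simps)
  finally have "(pderiv r * s - r * pderiv s) * (q * q) = (pderiv p * q - p * pderiv q) * (s * s)" .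
  with * assms show "g = Fract (pderiv p * q - p * pderiv q) (q * q)"
    by (simp add: eq_fract)
qed (use assms in blast)

text \<open>
  A rational differential form \<open>f dt\<close> is represented by its coefficient \<open>f\<close>; in particular
  \<open>fract_deriv u\<close> represents \<open>du\<close>. Its expansion at a point is taken with respect to the local
  parameter \<open>w\<close> there, so that \<open>form_at x f\<close> is the coefficient of \<open>dw\<close> (with
  \<open>dt = - w\<^sup>-\<^sup>2 dw\<close> at infinity).
\<close>

definition form_at :: "'k::field proj_line \<Rightarrow> 'k poly fract \<Rightarrow> 'k fls" where
  "form_at x f = fract_at x f * fls_deriv (coord_at x)"

definition form_residue :: "'k::field poly fract \<Rightarrow> 'k proj_line \<Rightarrow> 'k" where
  "form_residue f x = fls_residue (form_at x f)"

lemma fls_deriv_poly_at: "fls_deriv (poly_at x p) = poly_at x (pderiv p) * fls_deriv (coord_at x)"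
  by (induction p)
     (simp_all add: poly_at_pCons poly_at_add pderiv_pCons algebra_simps)

lemma form_at_fract_deriv: "form_at x (fract_deriv u) = fls_deriv (fract_at x u)"
proof (cases u)
  case (Fract p q)
  define F where "F = fract_at x u"
  let ?P = "poly_at x p" and ?Q = "poly_at x q" and ?t = "fls_deriv (coord_at x)"
  let ?P' = "poly_at x (pderiv p)" and ?Q' = "poly_at x (pderiv q)"
  have Q: "?Q \<noteq> 0"
    using Fract by simp
  have F: "F * ?Q = ?P"
    using Q Fract by (simp add: F_def fract_at_Fract)
  then have "fls_deriv (F * ?Q) = fls_deriv ?P"
    by simp
  then have "fls_deriv F * ?Q = (?P' - F * ?Q') * ?t"
    by (simp add: fls_deriv_poly_at algebra_simps)
  then have "fls_deriv F * ?Q * ?Q = (?P' - F * ?Q') * ?t * ?Q"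
    by (simp only:)
  then have "fls_deriv F * (?Q * ?Q) = (?P' * ?Q - (F * ?Q) * ?Q') * ?t"
    by (simp add: algebra_simps)
  then have "fls_deriv F = (?P' * ?Q - ?P * ?Q') / (?Q * ?Q) * ?t"
    using Q by (simp add: F field_simps)
  moreover have "poly_at x (pderiv p * q - p * pderiv q) = ?P' * ?Q - ?P * ?Q'"
    using poly_at_add[of x "pderiv p * q - p * pderiv q" "p * pderiv q"]
    by (simp add: poly_at_mult)
  ultimately show ?thesis
    using Fract by (simp add: form_at_def fract_deriv_Fract fract_at_Fract poly_at_mult F_def)
qed

text \<open>Divisors are integer-valued functions on the projective line; only a nonzero form has one.\<close>

definition form_has_divisor :: "'k::field poly fract \<Rightarrow> ('k proj_line \<Rightarrow> int) \<Rightarrow> bool" where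
  "form_has_divisor f D \<longleftrightarrow> f \<noteq> 0 \<and> (\<forall>x. fls_subdegree (form_at x f) = D x)"

definition point_divisor :: "'k proj_line \<Rightarrow> 'k proj_line \<Rightarrow> int" where
  "point_divisor x y = (if y = x then 1 else 0)"


section \<open>Realizable vertices\<close>

text \<open>The divisor \<open>- (\<Sum>a. (m(a) + 1) [j(a)])\<close>, the sum being over the edges with origin \<open>s\<close>.\<close>

definition vertex_divisor ::
  "('v, 'e) serre_graph \<Rightarrow> ('v, 'e, 'p::prime_card) hurwitz_datum \<Rightarrow> 'v \<Rightarrow> ('e \<Rightarrow> 'k proj_line) \<Rightarrow>
    'k proj_line \<Rightarrow> int" where
  "vertex_divisor \<Gamma> H s j x = - (\<Sum>a\<in>arcs_from \<Gamma> s. (ht_m H a + 1) * point_divisor (j a) x)"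

text \<open>Here \<open>of_int (to_int_mod_ring c)\<close> is the image of \<open>c\<close> in a field of characteristic \<open>CARD('p)\<close>.\<close>

definition multiplicative_realizable ::
  "'k::field itself \<Rightarrow> ('v, 'e) serre_graph \<Rightarrow> ('v, 'e, 'p::prime_card) hurwitz_datum \<Rightarrow> 'v \<Rightarrow> bool" where
  "multiplicative_realizable _ \<Gamma> H s \<longleftrightarrow>
     (\<exists>(u :: 'k poly fract) j. u \<noteq> 0 \<and> inj_on j (arcs_from \<Gamma> s) \<and>
        (\<forall>a\<in>arcs_from \<Gamma> s.
           form_residue (fract_deriv u / u) (j a) = of_int (to_int_mod_ring (ht_h H a))) \<and>
        form_has_divisor (fract_deriv u / u) (vertex_divisor \<Gamma> H s j))"

definition additive_realizable ::
  "'k::field itself \<Rightarrow> ('v, 'e) serre_graph \<Rightarrow> ('v, 'e, 'p::prime_card) hurwitz_datum \<Rightarrow> 'v \<Rightarrow> bool" where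
  "additive_realizable _ \<Gamma> H s \<longleftrightarrow>
     (\<exists>(u :: 'k poly fract) j. inj_on j (arcs_from \<Gamma> s) \<and>
        form_has_divisor (fract_deriv u) (vertex_divisor \<Gamma> H s j))"

text \<open>The notion is meant only for multiplicative and additive vertices.\<close>

definition realizable ::
  "'k::field itself \<Rightarrow> int \<Rightarrow> ('v, 'e) serre_graph \<Rightarrow> ('v, 'e, 'p::prime_card) hurwitz_datum \<Rightarrow> 'v \<Rightarrow> bool" where
  "realizable k vp \<Gamma> H s \<longleftrightarrow>
     multiplicative_vertex vp \<Gamma> H s \<and> multiplicative_realizable k \<Gamma> H s \<or>
     additive_vertex vp \<Gamma> H s \<and> additive_realizable k \<Gamma> H s"

text \<open>
  The family \<open>e\<close> of the additive case: \<open>m(a)\<close> on the edges, and \<open>-1\<close> on the added finite set.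
\<close>

definition additive_family ::
  "('v, 'e, 'p::prime_card) hurwitz_datum \<Rightarrow> 'e + 'i \<Rightarrow> 'p mod_ring" where
  "additive_family H = case_sum (\<lambda>a. of_int (ht_m H a)) (\<lambda>_. - 1)"

end

theory Submission
  imports Defs "HOL-Library.FuncSet"
begin

text \<open>
  In both parts a realization amounts to distinct points \<open>x\<^sub>i\<close> of \<open>k\<close>, indexed by the \<open>m + 1\<close> elements of
  \<open>I\<close>, such that \<open>\<Sum>i. e\<^sub>i / (t - x\<^sub>i) = c / \<Prod>i. (t - x\<^sub>i)\<close> with a nonzero constant \<open>c\<close>, the remaining
  edge being sent to infinity: in case (a) take \<open>u = \<Prod>i. (t - x\<^sub>i)\<^bsup>h\<^sub>i\<^esup>\<close>, and in case (b) take
  \<open>u = (\<Prod>z. (t - z)) / (\<Prod>a. (t - x\<^sub>a)\<^bsup>m(a)\<^esup>)\<close>, the points \<open>z\<close> being those of the added finite set.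
  The condition says that the power sums \<open>\<Sum>i. e\<^sub>i x\<^sub>i\<^sup>k\<close> vanish for all \<open>k < m\<close>; since the \<open>e\<^sub>i\<close> lie in the
  prime field, Frobenius reduces this to \<open>k = 0\<close>, where it holds anyway, and to the \<open>m - 1 - [m/p]\<close>
  positive exponents prime to \<open>p\<close>. A point that is constant on the blocks of \<open>P\<close>, with distinct values on
  distinct blocks, is a solution. Fixing one coordinate in each block leaves \<open>m + 1 - card P \<ge> m - [m/p]\<close>
  coordinates, more than there are equations, so by Krull's height theorem and the Nullstellensatz there is
  a further solution that still separates the blocks. By Vandermonde the fibres of a noninjective solution
  form an adapted partition; here it would be strictly finer than \<open>P\<close>.
\<close>

section \<open>Relations over a subring modulo a prime ideal\<close>

definition is_subring :: "'a::comm_ring_1 set \<Rightarrow> bool" where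
  "is_subring S \<longleftrightarrow> 1 \<in> S \<and> (\<forall>x\<in>S. \<forall>y\<in>S. x - y \<in> S \<and> x * y \<in> S)"

definition is_ideal :: "'a::comm_ring_1 set \<Rightarrow> 'a set \<Rightarrow> bool" where
  "is_ideal S I \<longleftrightarrow> I \<subseteq> S \<and> 0 \<in> I \<and> (\<forall>x\<in>I. \<forall>y\<in>I. x + y \<in> I) \<and> (\<forall>x\<in>S. \<forall>y\<in>I. x * y \<in> I)"

definition is_prime_ideal :: "'a::comm_ring_1 set \<Rightarrow> 'a set \<Rightarrow> bool" where
  "is_prime_ideal S P \<longleftrightarrow> is_ideal S P \<and> 1 \<notin> P \<and> (\<forall>x\<in>S. \<forall>y\<in>S. x * y \<in> P \<longrightarrow> x \<in> P \<or> y \<in> P)"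

definition polys_over :: "'a::comm_ring_1 set \<Rightarrow> 'a poly set" where
  "polys_over S = {F. \<forall>i. coeff F i \<in> S}"

definition adjoin :: "'a::comm_ring_1 set \<Rightarrow> 'a \<Rightarrow> 'a set" where
  "adjoin S x = (\<lambda>F. poly F x) ` polys_over S"

lemma subring_diff: "is_subring S \<Longrightarrow> x \<in> S \<Longrightarrow> y \<in> S \<Longrightarrow> x - y \<in> S"
  and subring_mult: "is_subring S \<Longrightarrow> x \<in> S \<Longrightarrow> y \<in> S \<Longrightarrow> x * y \<in> S"
  and subring_1: "is_subring S \<Longrightarrow> 1 \<in> S"
  by (simp_all add: is_subring_def)

lemma subring_0: "is_subring S \<Longrightarrow> 0 \<in> S"
  using subring_diff[of S 1 1] subring_1[of S] by simp

lemma subring_uminus: "is_subring S \<Longrightarrow> x \<in> S \<Longrightarrow> - x \<in> S"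
  using subring_diff[of S 0 x] subring_0[of S] by simp

lemma subring_add: "is_subring S \<Longrightarrow> x \<in> S \<Longrightarrow> y \<in> S \<Longrightarrow> x + y \<in> S"
  using subring_diff[of S x "- y"] subring_uminus[of S y] by simp

lemma subring_power: "is_subring S \<Longrightarrow> x \<in> S \<Longrightarrow> x ^ n \<in> S"
  by (induction n) (auto intro: subring_1 subring_mult)

lemma subring_sum: "is_subring S \<Longrightarrow> (\<And>i. i \<in> A \<Longrightarrow> f i \<in> S) \<Longrightarrow> sum f A \<in> S"
  by (induction A rule: infinite_finite_induct) (auto intro: subring_0 subring_add)

lemma subring_prod: "is_subring S \<Longrightarrow> (\<And>i. i \<in> A \<Longrightarrow> f i \<in> S) \<Longrightarrow> prod f A \<in> S"
  by (induction A rule: infinite_finite_induct) (auto intro: subring_1 subring_mult)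

lemmas subring_intros = subring_0 subring_1 subring_add subring_diff subring_uminus subring_mult
  subring_power subring_sum subring_prod

lemma ideal_subset: "is_ideal S I \<Longrightarrow> x \<in> I \<Longrightarrow> x \<in> S"
  and ideal_0: "is_ideal S I \<Longrightarrow> 0 \<in> I"
  and ideal_add: "is_ideal S I \<Longrightarrow> x \<in> I \<Longrightarrow> y \<in> I \<Longrightarrow> x + y \<in> I"
  and ideal_mult: "is_ideal S I \<Longrightarrow> x \<in> S \<Longrightarrow> y \<in> I \<Longrightarrow> x * y \<in> I"
  by (auto simp: is_ideal_def)

lemma ideal_diff:
  assumes "is_subring S" "is_ideal S I" "x \<in> I" "y \<in> I"
  shows "x - y \<in> I"
proof -
  have "- 1 \<in> S"
    using assms(1) by (intro subring_intros)
  then have "- 1 * y \<in> I"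
    using assms ideal_mult by blast
  then show ?thesis
    using ideal_add[OF assms(2,3)] by fastforce
qed

lemma ideal_sum: "is_ideal S I \<Longrightarrow> (\<And>i. i \<in> A \<Longrightarrow> f i \<in> I) \<Longrightarrow> sum f A \<in> I"
  by (induction A rule: infinite_finite_induct) (auto intro: ideal_0 ideal_add)

lemma prime_ideal_ideal: "is_prime_ideal S P \<Longrightarrow> is_ideal S P"
  by (simp add: is_prime_ideal_def)

lemma prime_ideal_cases: "is_prime_ideal S P \<Longrightarrow> x \<in> S \<Longrightarrow> y \<in> S \<Longrightarrow> x * y \<in> P \<Longrightarrow> x \<in> P \<or> y \<in> P"
  by (simp add: is_prime_ideal_def)

lemma prime_ideal_power:
  assumes "is_subring S" "is_prime_ideal S P" "x \<in> S" "x ^ n \<in> P"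
  shows "x \<in> P"
  using assms(4)
proof (induction n)
  case 0
  then show ?case
    using assms(2) by (simp add: is_prime_ideal_def)
next
  case (Suc n)
  then show ?case
    using prime_ideal_cases[OF assms(2,3), of "x ^ n"] subring_power[OF assms(1,3)] by auto
qed

lemma prime_ideal_power_mult:
  assumes "is_subring S" "is_prime_ideal S P" "x \<in> S" "x \<notin> P" "y \<in> S" "x ^ n * y \<in> P"
  shows "y \<in> P"
  using assms prime_ideal_cases[OF assms(2) subring_power[OF assms(1,3)] assms(5,6)] prime_ideal_power
  by blast

text \<open>The set is the ideal generated by \<open>I\<close> and \<open>h\<close>, described by
  congruences modulo \<open>I\<close>, the form in which it is used below.\<close>

lemma ideal_add_principal:
  assumes S: "is_subring S" and I: "is_ideal S I" and h: "h \<in> S"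
  shows "is_ideal S {y \<in> S. \<exists>u\<in>S. y - u * h \<in> I}"
  unfolding is_ideal_def
proof (intro conjI ballI)
  show "0 \<in> {y \<in> S. \<exists>u\<in>S. y - u * h \<in> I}"
    using subring_0[OF S] ideal_0[OF I] by force
  fix x y
  assume y: "y \<in> {y \<in> S. \<exists>u\<in>S. y - u * h \<in> I}"
  then obtain u where u: "y \<in> S" "u \<in> S" "y - u * h \<in> I"
    by blast
  {
    assume "x \<in> {y \<in> S. \<exists>u\<in>S. y - u * h \<in> I}"
    then obtain w where w: "x \<in> S" "w \<in> S" "x - w * h \<in> I"
      by blast
    have "(x + y) - (w + u) * h = (x - w * h) + (y - u * h)"
      by (simp add: algebra_simps)
    then have "(x + y) - (w + u) * h \<in> I"
      using ideal_add[OF I w(3) u(3)] by (simp only:)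
    then show "x + y \<in> {y \<in> S. \<exists>u\<in>S. y - u * h \<in> I}"
      using u w subring_add[OF S] by blast
  }
  assume x: "x \<in> S"
  have "x * y - (x * u) * h = x * (y - u * h)"
    by (simp add: algebra_simps)
  then have "x * y - (x * u) * h \<in> I"
    using ideal_mult[OF I x u(3)] by (simp only:)
  then show "x * y \<in> {y \<in> S. \<exists>u\<in>S. y - u * h \<in> I}"
    using u x subring_mult[OF S x] by blast
qed blast

text \<open>An ideal maximal among those that contain \<open>I\<close> and avoid every power of
  \<open>h\<close> is prime; Zorn's lemma provides one, since unions of chains keep both
  properties.\<close>

lemma prime_ideal_avoiding_powers:
  assumes S: "is_subring S" and I: "is_ideal S I" and h: "h \<in> S" and hI: "\<And>k. h ^ k \<notin> I"
  obtains P where "I \<subseteq> P" "is_prime_ideal S P" "h \<notin> P"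
proof -
  define C where "C = {J. is_ideal S J \<and> I \<subseteq> J \<and> (\<forall>k. h ^ k \<notin> J)}"
  have "\<exists>M\<in>C. \<forall>X\<in>C. M \<subseteq> X \<longrightarrow> X = M"
  proof (rule subset_Zorn_nonempty)
    show "C \<noteq> {}"
      using I hI by (auto simp: C_def)
    fix \<C>
    assume ne: "\<C> \<noteq> {}" and chain: "subset.chain C \<C>"
    then have sub: "\<C> \<subseteq> C" and lin: "\<And>X Y. X \<in> \<C> \<Longrightarrow> Y \<in> \<C> \<Longrightarrow> X \<subseteq> Y \<or> Y \<subseteq> X"
      by (auto simp: subset.chain_def)
    have "is_ideal S (\<Union>\<C>)"
      unfolding is_ideal_def
    proof (intro conjI ballI)
      show "\<Union>\<C> \<subseteq> S"
        using sub by (auto simp: C_def is_ideal_def)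
      show "0 \<in> \<Union>\<C>"
        using sub ne by (auto simp: C_def intro: ideal_0)
      fix x y
      assume y: "y \<in> \<Union>\<C>"
      {
        assume x: "x \<in> \<Union>\<C>"
        with y obtain X Y where "X \<in> \<C>" "x \<in> X" "Y \<in> \<C>" "y \<in> Y"
          by blast
        with lin[of X Y] obtain Z where "Z \<in> \<C>" "x \<in> Z" "y \<in> Z"
          by blast
        then show "x + y \<in> \<Union>\<C>"
          using sub ideal_add[of S Z x y] by (auto simp: C_def)
      }
      assume x: "x \<in> S"
      from y obtain Z where "Z \<in> \<C>" "y \<in> Z"
        by blast
      then show "x * y \<in> \<Union>\<C>"
        using sub ideal_mult[of S Z x y] x by (auto simp: C_def)
    qed
    moreover have "I \<subseteq> \<Union>\<C>" "h ^ k \<notin> \<Union>\<C>" for k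
      using sub ne by (auto simp: C_def)
    ultimately show "\<Union>\<C> \<in> C"
      by (simp add: C_def)
  qed
  then obtain P where P: "P \<in> C" and max: "\<And>X. X \<in> C \<Longrightarrow> P \<subseteq> X \<Longrightarrow> X = P"
    by blast
  then have idl: "is_ideal S P" and IP: "I \<subseteq> P" and hP: "\<And>k. h ^ k \<notin> P"
    by (auto simp: C_def)
  \<comment> \<open>Adding \<open>x\<close> to the maximal ideal \<open>P\<close> must bring in a
    power of \<open>h\<close>, since the enlarged ideal leaves the class \<open>C\<close>.\<close>
  have ext: "\<exists>k. \<exists>u\<in>S. h ^ k - u * x \<in> P" if x: "x \<in> S" "x \<notin> P" for x
  proof (rule ccontr)
    assume neg: "\<not> ?thesis"
    let ?J = "{y \<in> S. \<exists>u\<in>S. y - u * x \<in> P}"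
    have "P \<subseteq> ?J"
      using ideal_subset[OF idl] subring_0[OF S] by force
    moreover from this have "?J \<in> C"
      using ideal_add_principal[OF S idl x(1)] neg IP unfolding C_def by blast
    ultimately have "?J = P"
      using max by blast
    moreover have "x \<in> ?J"
      using x subring_1[OF S] ideal_0[OF idl] by force
    ultimately show False
      using x by blast
  qed
  have "x \<in> P \<or> y \<in> P" if x: "x \<in> S" and y: "y \<in> S" and xy: "x * y \<in> P" for x y
  proof (rule ccontr)
    assume "\<not> ?thesis"
    then obtain k u l w where k: "u \<in> S" "h ^ k - u * x \<in> P" and l: "w \<in> S" "h ^ l - w * y \<in> P"
      using ext x y by blast
    \<comment> \<open>The product of the two congruences \<open>h ^ k = u * x\<close> and
      \<open>h ^ l = w * y\<close> modulo \<open>P\<close>; each term on the right lies in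
      \<open>P\<close>.\<close>
    have "h ^ (k + l) = h ^ l * (h ^ k - u * x) + (u * x) * (h ^ l - w * y) + (u * w) * (x * y)"
      by (simp add: algebra_simps power_add)
    also have "\<dots> \<in> P"
      by (intro ideal_add[OF idl] ideal_mult[OF idl _ k(2)] ideal_mult[OF idl _ l(2)]
          ideal_mult[OF idl _ xy] subring_mult[OF S] subring_power[OF S] k(1) l(1) x h)
    finally show False
      using hP by blast
  qed
  then have "is_prime_ideal S P"
    using idl hP[of 0] by (auto simp: is_prime_ideal_def)
  then show ?thesis
    using that IP hP[of 1] by simp
qed

section \<open>Polynomials over a subring and relations of minimal degree\<close>

lemma polys_overD: "F \<in> polys_over S \<Longrightarrow> coeff F i \<in> S"
  by (simp add: polys_over_def)

lemma polys_over_0: "0 \<in> S \<Longrightarrow> 0 \<in> polys_over S"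
  and polys_over_monom: "0 \<in> S \<Longrightarrow> a \<in> S \<Longrightarrow> monom a n \<in> polys_over S"
  and polys_over_const: "0 \<in> S \<Longrightarrow> a \<in> S \<Longrightarrow> [:a:] \<in> polys_over S"
  and polys_over_cutoff: "0 \<in> S \<Longrightarrow> F \<in> polys_over S \<Longrightarrow> poly_cutoff n F \<in> polys_over S"
  by (auto simp: polys_over_def coeff_monom coeff_pCons coeff_poly_cutoff split: nat.split)

lemma polys_over_add: "is_subring S \<Longrightarrow> F \<in> polys_over S \<Longrightarrow> G \<in> polys_over S \<Longrightarrow> F + G \<in> polys_over S"
  and polys_over_diff: "is_subring S \<Longrightarrow> F \<in> polys_over S \<Longrightarrow> G \<in> polys_over S \<Longrightarrow> F - G \<in> polys_over S"
  and polys_over_smult: "is_subring S \<Longrightarrow> a \<in> S \<Longrightarrow> F \<in> polys_over S \<Longrightarrow> smult a F \<in> polys_over S"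
  and polys_over_mult: "is_subring S \<Longrightarrow> F \<in> polys_over S \<Longrightarrow> G \<in> polys_over S \<Longrightarrow> F * G \<in> polys_over S"
  by (auto simp: polys_over_def coeff_mult intro!: subring_add subring_diff subring_mult subring_sum)

lemma subring_adjoin:
  assumes S: "is_subring S"
  shows "is_subring (adjoin S x)"
  unfolding is_subring_def
proof (intro conjI ballI)
  show "1 \<in> adjoin S x"
    unfolding adjoin_def
    by (rule image_eqI[of _ _ "[:1:]"]) (auto intro: polys_over_const subring_intros S)
  fix a b
  assume "a \<in> adjoin S x" "b \<in> adjoin S x"
  then obtain F G where FG: "F \<in> polys_over S" "G \<in> polys_over S" and "a = poly F x" "b = poly G x"
    by (auto simp: adjoin_def)
  then have "a - b = poly (F - G) x" "a * b = poly (F * G) x"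
    by simp_all
  with FG show "a - b \<in> adjoin S x" "a * b \<in> adjoin S x"
    unfolding adjoin_def by (blast intro: polys_over_diff polys_over_mult S)+
qed

lemma poly_in_adjoin: "F \<in> polys_over S \<Longrightarrow> poly F x \<in> adjoin S x"
  by (simp add: adjoin_def)

lemma subset_adjoin: "is_subring S \<Longrightarrow> S \<subseteq> adjoin S x"
proof
  fix a
  assume "is_subring S" "a \<in> S"
  then have "poly [:a:] x \<in> adjoin S x"
    by (intro poly_in_adjoin polys_over_const subring_0)
  then show "a \<in> adjoin S x"
    by simp
qed

lemma self_in_adjoin: "is_subring S \<Longrightarrow> x \<in> adjoin S x"
  using poly_in_adjoin[OF polys_over_monom, of S 1 1 x] by (simp add: subring_intros poly_monom)

lemma poly_in_ideal:
  assumes S: "is_subring S" and I: "is_ideal S I" and x: "x \<in> S" and F: "F \<in> polys_over I"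
  shows "poly F x \<in> I"
proof -
  have "poly F x = (\<Sum>i\<le>degree F. x ^ i * coeff F i)"
    by (simp add: poly_altdef mult.commute)
  then show ?thesis
    using polys_overD[OF F] by (auto intro!: ideal_sum[OF I] ideal_mult[OF I] subring_power[OF S x])
qed

text \<open>Division without inverting the leading coefficient of \<open>F\<close>: each round
  multiplies by it and cancels the top term. Degree bounds are phrased by vanishing coefficients, so
  that for \<open>degree F = 0\<close> the remainder is forced to be zero.\<close>

lemma pseudo_division:
  assumes S: "is_subring S" and F: "F \<in> polys_over S" and H: "H \<in> polys_over S"
    and deg: "\<And>i. n \<le> i \<Longrightarrow> coeff H i = 0"
  shows "\<exists>N. \<exists>Q\<in>polys_over S. \<exists>R\<in>polys_over S. smult (lead_coeff F ^ N) H = Q * F + R \<and>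
    (\<forall>i. n \<le> i + degree F \<longrightarrow> coeff Q i = 0) \<and> (\<forall>i\<ge>degree F. coeff R i = 0)"
  using H deg
proof (induction n arbitrary: H)
  case 0
  then have "H = 0"
    by (auto intro: poly_eqI)
  then show ?case
    using polys_over_0[OF subring_0[OF S]] by (intro exI[of _ 0] bexI[of _ 0]) auto
next
  case (Suc n)
  let ?d = "degree F" and ?c = "lead_coeff F"
  show ?case
  proof (cases "n < ?d")
    case True
    then show ?thesis
      using Suc.prems polys_over_0[OF subring_0[OF S]]
      by (intro exI[of _ 0] bexI[of _ 0] bexI[of _ H]) auto
  next
    case False
    define M where "M = monom (coeff H n) (n - ?d)"
    have M: "M \<in> polys_over S"
      unfolding M_def using Suc.prems(1) by (intro polys_over_monom subring_0 S polys_overD)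
    have c: "?c \<in> S"
      using F by (rule polys_overD)
    have "coeff (smult ?c H - M * F) i = 0" if "n \<le> i" for i
    proof (cases "i = n")
      case True
      then show ?thesis
        using False mult.commute[of ?c "coeff H n"] by (simp add: M_def coeff_monom_mult)
    next
      case neq: False
      then have "coeff F (i - (n - ?d)) = 0"
        using that False by (intro coeff_eq_0) auto
      then show ?thesis
        using neq that Suc.prems(2)[of i] by (simp add: M_def coeff_monom_mult)
    qed
    moreover have "smult ?c H - M * F \<in> polys_over S"
      using c M F Suc.prems(1) by (intro polys_over_diff polys_over_smult polys_over_mult S)
    ultimately obtain N Q R where Q: "Q \<in> polys_over S" and R: "R \<in> polys_over S"
      and eq: "smult (?c ^ N) (smult ?c H - M * F) = Q * F + R"
      and dQ: "\<forall>i. n \<le> i + ?d \<longrightarrow> coeff Q i = 0" and dR: "\<forall>i\<ge>?d. coeff R i = 0"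
      using Suc.IH by blast
    have "smult (?c ^ Suc N) H = (Q + smult (?c ^ N) M) * F + R"
      using eq by (simp add: algebra_simps smult_diff_right)
    moreover have "Q + smult (?c ^ N) M \<in> polys_over S"
      using Q M c by (intro polys_over_add polys_over_smult subring_power S)
    moreover have "\<forall>i. Suc n \<le> i + ?d \<longrightarrow> coeff (Q + smult (?c ^ N) M) i = 0"
      using dQ False by (auto simp: M_def)
    ultimately show ?thesis
      using R dR by blast
  qed
qed

text \<open>Among the polynomials over \<open>S\<close> with value in \<open>J\<close> and leading
  coefficient outside \<open>P\<close>, one of least degree is taken. This is applied with
  \<open>J\<close> equal to \<open>P\<close> and with \<open>J\<close> generated by \<open>P\<close>
  and one more element.\<close>

lemma minimal_relation:
  assumes S: "is_subring S" and J: "is_ideal (adjoin S x) J"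
    and P: "is_ideal (adjoin S x) P" "P \<subseteq> J"
    and F\<^sub>0: "F\<^sub>0 \<in> polys_over S" "poly F\<^sub>0 x \<in> J" "coeff F\<^sub>0 i\<^sub>0 \<notin> P"
  obtains F where "F \<in> polys_over S" "poly F x \<in> J" "lead_coeff F \<notin> P"
    "\<And>H. H \<in> polys_over S \<Longrightarrow> poly H x \<in> J \<Longrightarrow> (\<And>i. degree F \<le> i \<Longrightarrow> coeff H i = 0) \<Longrightarrow> H \<in> polys_over P"
proof -
  let ?T = "adjoin S x"
  have T: "is_subring ?T"
    using S by (rule subring_adjoin)
  define rel where "rel n F \<longleftrightarrow> F \<in> polys_over S \<and> poly F x \<in> J \<and> coeff F n \<notin> P \<and> degree F = n" for n F
  \<comment> \<open>The coefficients above the last one outside \<open>P\<close> contribute only an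
    element of \<open>P\<close> to the value; cutting them off keeps the value in
    \<open>J\<close>.\<close>
  have trunc: "\<exists>k F. k \<le> degree H \<and> rel k F" if H: "H \<in> polys_over S" "poly H x \<in> J" "coeff H i \<notin> P" for H i
  proof -
    define k where "k = Max {i. coeff H i \<notin> P}"
    have bdd: "{i. coeff H i \<notin> P} \<subseteq> {..degree H}"
      using ideal_0[OF P(1)] by (auto intro: le_degree)
    then have fin: "finite {i. coeff H i \<notin> P}"
      by (rule finite_subset) simp
    have kP: "coeff H k \<notin> P"
      using Max_in[OF fin] H(3) by (auto simp: k_def)
    have kmax: "coeff H l \<in> P" if "k < l" for l
      using Max_ge[OF fin, of l] that by (auto simp: k_def)
    define F where "F = poly_cutoff (Suc k) H"
    have "H - F \<in> polys_over P"
      using kmax ideal_0[OF P(1)] by (auto simp: polys_over_def F_def coeff_poly_cutoff)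
    then have "poly (H - F) x \<in> P"
      by (rule poly_in_ideal[OF T P(1) self_in_adjoin[OF S]])
    then have "poly H x - poly (H - F) x \<in> J"
      using P(2) H(2) by (intro ideal_diff[OF T J]) auto
    then have "poly F x \<in> J"
      by simp
    moreover have "F \<in> polys_over S"
      unfolding F_def using H(1) by (intro polys_over_cutoff subring_0 S)
    moreover have cF: "coeff F k \<notin> P"
      using kP by (simp add: F_def coeff_poly_cutoff)
    moreover have "degree F = k"
    proof (rule antisym)
      show "degree F \<le> k"
        by (rule degree_le) (simp add: F_def coeff_poly_cutoff)
      show "k \<le> degree F"
        using cF ideal_0[OF P(1)] by (intro le_degree) auto
    qed
    ultimately show ?thesis
      using bdd kP by (auto simp: rel_def)
  qed
  define n where "n = (LEAST n. \<exists>F. rel n F)"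
  have "\<exists>n F. rel n F"
    using trunc[OF F\<^sub>0] by blast
  then have "\<exists>F. rel n F"
    unfolding n_def by (rule LeastI_ex)
  then obtain F where F: "rel n F" ..
  show ?thesis
  proof (rule that[of F])
    fix H
    assume H: "H \<in> polys_over S" "poly H x \<in> J" and deg: "\<And>i. degree F \<le> i \<Longrightarrow> coeff H i = 0"
    show "H \<in> polys_over P"
    proof (rule ccontr)
      assume "H \<notin> polys_over P"
      then obtain i where i: "coeff H i \<notin> P"
        by (auto simp: polys_over_def)
      then obtain k G where "k \<le> degree H" "rel k G"
        using trunc H by blast
      moreover have "n \<le> k" if "rel k G" for k G
        unfolding n_def using that by (intro Least_le exI)
      ultimately have "n \<le> degree H"
        using le_trans by blast
      moreover have "lead_coeff H \<noteq> 0"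
        using i ideal_0[OF P(1)] by (metis coeff_0 leading_coeff_0_iff)
      ultimately show False
        using deg[of "degree H"] F by (auto simp: rel_def)
    qed
  qed (use F in \<open>auto simp: rel_def\<close>)
qed

text \<open>
  Algebraic case: \<open>x\<close> satisfies a nontrivial relation over \<open>S\<close> modulo \<open>P\<close>. Divisions by a relation
  of minimal degree replace the passage to the fraction field of \<open>S / (P \<inter> S)\<close>.
\<close>

lemma algebraic_adjoin:
  assumes S: "is_subring S" and P: "is_prime_ideal (adjoin S x) P"
    and F\<^sub>0: "F\<^sub>0 \<in> polys_over S" "poly F\<^sub>0 x \<in> P" "coeff F\<^sub>0 i\<^sub>0 \<notin> P"
  obtains F where "F \<in> polys_over S" "poly F x \<in> P" "lead_coeff F \<notin> P" "0 < degree F"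
    "\<And>H. H \<in> polys_over S \<Longrightarrow> poly H x \<in> P \<Longrightarrow>
      \<exists>N. \<exists>Q\<in>polys_over S. \<exists>R\<in>polys_over P. smult (lead_coeff F ^ N) H = Q * F + R"
    "\<And>h. h \<in> adjoin S x \<Longrightarrow> h \<notin> P \<Longrightarrow> \<exists>a\<in>S. a \<notin> P \<and> (\<exists>u\<in>adjoin S x. a - u * h \<in> P)"
proof -
  let ?T = "adjoin S x"
  have T: "is_subring ?T"
    using S by (rule subring_adjoin)
  have PT: "is_ideal ?T P"
    using P by (rule prime_ideal_ideal)
  have ST: "a \<in> ?T" if "a \<in> S" for a
    using subset_adjoin[OF S] that by blast
  obtain F where F: "F \<in> polys_over S" "poly F x \<in> P" "lead_coeff F \<notin> P"
    and Fmin: "\<And>H. H \<in> polys_over S \<Longrightarrow> poly H x \<in> P \<Longrightarrow> (\<And>i. degree F \<le> i \<Longrightarrow> coeff H i = 0) \<Longrightarrow>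
      H \<in> polys_over P"
    using minimal_relation[OF S PT PT order_refl F\<^sub>0] by blast
  have "degree F \<noteq> 0"
  proof
    assume d: "degree F = 0"
    then have "poly F x = lead_coeff F"
      by (simp add: poly_altdef)
    with F show False
      by simp
  qed
  moreover have "\<exists>N. \<exists>Q\<in>polys_over S. \<exists>R\<in>polys_over P. smult (lead_coeff F ^ N) H = Q * F + R"
    if H: "H \<in> polys_over S" "poly H x \<in> P" for H
  proof -
    have "coeff H i = 0" if "Suc (degree H) \<le> i" for i
      using that by (simp add: coeff_eq_0)
    from pseudo_division[OF S F(1) H(1) this]
    obtain N Q R where Q: "Q \<in> polys_over S" and R: "R \<in> polys_over S"
      and eq: "smult (lead_coeff F ^ N) H = Q * F + R" and dR: "\<forall>i\<ge>degree F. coeff R i = 0"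
      by blast
    \<comment> \<open>The remainder has its value in \<open>P\<close> and no terms from
      \<open>degree F\<close> on, so minimality puts its coefficients in \<open>P\<close>.\<close>
    have "poly R x = poly (smult (lead_coeff F ^ N) H - Q * F) x"
      by (simp add: eq)
    also have "\<dots> = lead_coeff F ^ N * poly H x - poly Q x * poly F x"
      by simp
    also have "\<dots> \<in> P"
      using F H by (intro ideal_diff[OF T PT] ideal_mult[OF PT] poly_in_adjoin Q subring_power[OF T] ST polys_overD)
    finally have "R \<in> polys_over P"
      using Fmin R dR by blast
    with Q eq show ?thesis
      by blast
  qed
  moreover have "\<exists>a\<in>S. a \<notin> P \<and> (\<exists>u\<in>?T. a - u * h \<in> P)" if h: "h \<in> ?T" "h \<notin> P" for h
  proof -
    \<comment> \<open>The wanted element of \<open>S\<close> will be the leading coefficient of a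
      minimal relation \<open>R\<^sub>0\<close> for the ideal generated by \<open>P\<close> and
      \<open>h\<close>; the work is to show that \<open>R\<^sub>0\<close> is constant.\<close>
    define J where "J = {y \<in> ?T. \<exists>u\<in>?T. y - u * h \<in> P}"
    have J: "is_ideal ?T J"
      unfolding J_def using T PT h(1) by (rule ideal_add_principal)
    have PJ: "P \<subseteq> J"
      using ideal_subset[OF PT] subring_0[OF T] unfolding J_def by force
    have hJ: "h \<in> J"
      using h subring_1[OF T] ideal_0[OF PT] unfolding J_def by force
    obtain R\<^sub>0 where R\<^sub>0: "R\<^sub>0 \<in> polys_over S" "poly R\<^sub>0 x \<in> J" "lead_coeff R\<^sub>0 \<notin> P"
      and Rmin: "\<And>H. H \<in> polys_over S \<Longrightarrow> poly H x \<in> J \<Longrightarrow> (\<And>i. degree R\<^sub>0 \<le> i \<Longrightarrow> coeff H i = 0) \<Longrightarrow>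
        H \<in> polys_over P"
      using minimal_relation[OF S J PT PJ F(1) _ F(3)] F(2) PJ by blast
    let ?c = "lead_coeff R\<^sub>0"
    have c: "?c \<in> S"
      using R\<^sub>0(1) by (rule polys_overD)
    have divide: "\<exists>N. \<exists>Q\<in>polys_over S. \<exists>R\<in>polys_over P. smult (?c ^ N) H = Q * R\<^sub>0 + R \<and>
        (\<forall>i. Suc (degree H) \<le> i + degree R\<^sub>0 \<longrightarrow> coeff Q i = 0)"
      if H: "H \<in> polys_over S" "poly H x \<in> J" for H
    proof -
      have "coeff H i = 0" if "Suc (degree H) \<le> i" for i
        using that by (simp add: coeff_eq_0)
      from pseudo_division[OF S R\<^sub>0(1) H(1) this]
      obtain N Q R where Q: "Q \<in> polys_over S" and R: "R \<in> polys_over S"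
        and eq: "smult (?c ^ N) H = Q * R\<^sub>0 + R" and dR: "\<forall>i\<ge>degree R\<^sub>0. coeff R i = 0"
        and dQ: "\<forall>i. Suc (degree H) \<le> i + degree R\<^sub>0 \<longrightarrow> coeff Q i = 0"
        by blast
      have "poly R x = poly (smult (?c ^ N) H - Q * R\<^sub>0) x"
        by (simp add: eq)
      also have "\<dots> = ?c ^ N * poly H x - poly Q x * poly R\<^sub>0 x"
        by simp
      also have "\<dots> \<in> J"
        using R\<^sub>0 H by (intro ideal_diff[OF T J] ideal_mult[OF J] poly_in_adjoin Q subring_power[OF T] ST c)
      finally have "R \<in> polys_over P"
        using Rmin R dR by blast
      with Q eq dQ show ?thesis
        by blast
    qed
    have "degree R\<^sub>0 = 0"
    proof (rule ccontr)
      assume pos: "degree R\<^sub>0 \<noteq> 0"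
      \<comment> \<open>Pseudo-division of \<open>F\<close> by \<open>R\<^sub>0\<close> shows that
        the product of the values of \<open>Q\<close> and \<open>R\<^sub>0\<close> lies in
        \<open>P\<close>, so one of them does.\<close>
      obtain N Q R where Q: "Q \<in> polys_over S" and R: "R \<in> polys_over P"
        and eq: "smult (?c ^ N) F = Q * R\<^sub>0 + R" and dQ: "\<forall>i. Suc (degree F) \<le> i + degree R\<^sub>0 \<longrightarrow> coeff Q i = 0"
        using divide[OF F(1) subsetD[OF PJ F(2)]] by blast
      have Rx: "poly R x \<in> P"
        by (rule poly_in_ideal[OF T PT self_in_adjoin[OF S] R])
      have "poly Q x * poly R\<^sub>0 x = poly (smult (?c ^ N) F - R) x"
        by (simp add: eq)
      also have "\<dots> = ?c ^ N * poly F x - poly R x"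
        by simp
      also have "\<dots> \<in> P"
        using F Rx by (intro ideal_diff[OF T PT] ideal_mult[OF PT] subring_power[OF T] ST c)
      finally have "poly Q x \<in> P \<or> poly R\<^sub>0 x \<in> P"
        by (rule prime_ideal_cases[OF P poly_in_adjoin[OF Q] poly_in_adjoin[OF R\<^sub>0(1)]])
      then consider "poly Q x \<in> P" | "poly R\<^sub>0 x \<in> P"
        by blast
      then show False
      proof cases
        \<comment> \<open>\<open>Q\<close> has smaller degree than \<open>F\<close>, so its
          coefficients lie in \<open>P\<close>; comparing coefficients at \<open>degree F\<close>
          puts a power of \<open>?c\<close> times the leading coefficient of \<open>F\<close> in
          \<open>P\<close>.\<close>
        case 1
        then have QP: "Q \<in> polys_over P"
          using dQ pos by (intro Fmin Q) auto
        have "coeff (smult (?c ^ N) F) (degree F) \<in> P"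
          unfolding eq coeff_add coeff_mult
        proof (intro ideal_add[OF PT] ideal_sum[OF PT])
          show "coeff R (degree F) \<in> P"
            using R by (rule polys_overD)
          fix i
          have "coeff R\<^sub>0 (degree F - i) * coeff Q i \<in> P"
            by (intro ideal_mult[OF PT] polys_overD[OF QP] ST polys_overD[OF R\<^sub>0(1)])
          then show "coeff Q i * coeff R\<^sub>0 (degree F - i) \<in> P"
            by (simp add: mult.commute)
        qed
        then have "?c ^ N * lead_coeff F \<in> P"
          by simp
        then show False
          using prime_ideal_power_mult[OF T P ST[OF c] R\<^sub>0(3) ST[OF polys_overD[OF F(1)]]] F(3) by blast
      next
        \<comment> \<open>Dividing a polynomial with value \<open>h\<close> by
          \<open>R\<^sub>0\<close> puts a power of \<open>?c\<close> times \<open>h\<close> in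
          \<open>P\<close>, although neither \<open>?c\<close> nor \<open>h\<close> is in this prime
          ideal.\<close>
        case 2
        obtain G where G: "G \<in> polys_over S" "h = poly G x"
          using h(1) by (auto simp: adjoin_def)
        with hJ have "poly G x \<in> J"
          by simp
        from divide[OF G(1) this] obtain N Q R where Q: "Q \<in> polys_over S" and R: "R \<in> polys_over P"
          and eq: "smult (?c ^ N) G = Q * R\<^sub>0 + R"
          by blast
        have Rx: "poly R x \<in> P"
          by (rule poly_in_ideal[OF T PT self_in_adjoin[OF S] R])
        have "?c ^ N * h = poly (smult (?c ^ N) G) x"
          by (simp add: G)
        also have "\<dots> = poly Q x * poly R\<^sub>0 x + poly R x"
          by (simp add: eq)
        also have "\<dots> \<in> P"
          by (intro ideal_add[OF PT] ideal_mult[OF PT] poly_in_adjoin Q 2 Rx)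
        finally show False
          using prime_ideal_power_mult[OF T P ST[OF c] R\<^sub>0(3) h(1)] h(2) by blast
      qed
    qed
    then have "poly R\<^sub>0 x = ?c"
      by (simp add: poly_altdef)
    with R\<^sub>0 c show ?thesis
      by (auto simp: J_def)
  qed
  ultimately show ?thesis
    by (intro that[OF F]) auto
qed

section \<open>The Nullstellensatz\<close>

text \<open>Over a finite field the product of all t - a, plus 1, has positive degree and no
  root.\<close>

lemma infinite_UNIV_alg_closed: "infinite (UNIV :: 'k::alg_closed_field set)"
proof
  assume fin: "finite (UNIV :: 'k set)"
  define q where "q = (\<Prod>a\<in>(UNIV :: 'k set). [:- a, 1:]) + 1"
  have "degree (\<Prod>a\<in>(UNIV :: 'k set). [:- a, 1:]) = card (UNIV :: 'k set)"
    by (subst degree_prod_eq_sum_degree) auto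
  then have "degree q = card (UNIV :: 'k set)"
    unfolding q_def using fin by (subst degree_add_eq_left) (auto simp: card_gt_0_iff)
  then have "0 < degree q"
    using fin by (simp add: card_gt_0_iff)
  then obtain x where "poly q x = 0"
    using alg_closed_imp_poly_has_root by blast
  moreover have "poly (\<Prod>a\<in>(UNIV :: 'k set). [:- a, 1:]) x = 0"
    using fin by (simp add: poly_prod)
  ultimately show False
    by (simp add: q_def)
qed

lemma polys_over_pCons: "pCons c F \<in> polys_over S \<longleftrightarrow> c \<in> S \<and> F \<in> polys_over S"
proof
  assume "pCons c F \<in> polys_over S"
  then have "coeff (pCons c F) 0 \<in> S" "coeff (pCons c F) (Suc i) \<in> S" for i
    by (simp_all only: polys_overD)
  then show "c \<in> S \<and> F \<in> polys_over S"
    by (simp add: polys_over_def)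
qed (auto simp: polys_over_def coeff_pCons split: nat.split)

lemma prime_ideal_inter_subring:
  assumes S: "is_subring S" and ST: "S \<subseteq> T" and P: "is_prime_ideal T P"
  shows "is_prime_ideal S (P \<inter> S)"
proof -
  have "is_ideal T P"
    using P by (rule prime_ideal_ideal)
  then have "is_ideal S (P \<inter> S)"
    using S ST by (auto simp: is_ideal_def subring_0 subring_add subring_mult)
  then show ?thesis
    using P ST unfolding is_prime_ideal_def by blast
qed

text \<open>
  A polynomial function \<open>f\<close> on \<open>k\<^sup>\<nat>\<close> is represented by the map sending a point \<open>a\<close> to the polynomial
  \<open>f (t a)\<close> in one variable \<open>t\<close>: its value at \<open>a\<close> is read off at \<open>t = 1\<close>, and its Taylor
  expansion at the origin appears as the expansion in powers of \<open>t\<close>.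
\<close>

typedef (overloaded) 'k radial_fun = "UNIV :: ((nat \<Rightarrow> 'k::field) \<Rightarrow> 'k poly) set"
  morphisms expansion Radial_Fun
  by simp

setup_lifting type_definition_radial_fun

instantiation radial_fun :: (field) comm_ring_1
begin

lift_definition zero_radial_fun :: "'a radial_fun" is "\<lambda>a. 0" .
lift_definition one_radial_fun :: "'a radial_fun" is "\<lambda>a. 1" .
lift_definition plus_radial_fun :: "'a radial_fun \<Rightarrow> 'a radial_fun \<Rightarrow> 'a radial_fun" is "\<lambda>f g a. f a + g a" .
lift_definition minus_radial_fun :: "'a radial_fun \<Rightarrow> 'a radial_fun \<Rightarrow> 'a radial_fun" is "\<lambda>f g a. f a - g a" .
lift_definition uminus_radial_fun :: "'a radial_fun \<Rightarrow> 'a radial_fun" is "\<lambda>f a. - f a" .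
lift_definition times_radial_fun :: "'a radial_fun \<Rightarrow> 'a radial_fun \<Rightarrow> 'a radial_fun" is "\<lambda>f g a. f a * g a" .

instance
  by (intro_classes; transfer; simp add: fun_eq_iff algebra_simps)

end

lift_definition radial_coord :: "nat \<Rightarrow> 'k::field radial_fun" is "\<lambda>i a. [:0, a i:]" .

lift_definition radial_const :: "'k::field \<Rightarrow> 'k radial_fun" is "\<lambda>c a. [:c:]" .

lemma expansion_simps [simp]:
  "expansion 0 a = 0"
  "expansion 1 a = 1"
  "expansion (f + g) a = expansion f a + expansion g a"
  "expansion (f - g) a = expansion f a - expansion g a"
  "expansion (- f) a = - expansion f a"
  "expansion (f * g) a = expansion f a * expansion g a"
  "expansion (radial_coord i) a = [:0, a i:]"
  "expansion (radial_const c) a = [:c:]"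
  by (transfer; simp)+

lemma expansion_power [simp]: "expansion (f ^ n) a = expansion f a ^ n"
  by (induction n) simp_all

lemma expansion_sum: "expansion (sum f A) a = (\<Sum>i\<in>A. expansion (f i) a)"
  by (induction A rule: infinite_finite_induct) simp_all

lemma expansion_prod: "expansion (prod f A) a = (\<Prod>i\<in>A. expansion (f i) a)"
  by (induction A rule: infinite_finite_induct) simp_all

lemma radial_fun_eqI: "(\<And>a. expansion f a = expansion g a) \<Longrightarrow> f = g"
  by transfer auto

definition point_eval :: "'k::field radial_fun \<Rightarrow> (nat \<Rightarrow> 'k) \<Rightarrow> 'k" where
  "point_eval f a = poly (expansion f a) 1"

text \<open>The polynomial rings in the first \<open>n\<close> coordinates form a tower inside a
  single type, so that the Nullstellensatz can be proved by adjoining one coordinate at a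
  time.\<close>

primrec coord_ring :: "nat \<Rightarrow> 'k::field radial_fun set" where
  "coord_ring 0 = range radial_const"
| "coord_ring (Suc n) = adjoin (coord_ring n) (radial_coord n)"

lemma point_eval_simps [simp]:
  "point_eval 0 a = 0"
  "point_eval 1 a = 1"
  "point_eval (f + g) a = point_eval f a + point_eval g a"
  "point_eval (f - g) a = point_eval f a - point_eval g a"
  "point_eval (f * g) a = point_eval f a * point_eval g a"
  "point_eval (radial_coord i) a = a i"
  "point_eval (radial_const c) a = c"
  by (simp_all add: point_eval_def)

lemma point_eval_power [simp]: "point_eval (f ^ n) a = point_eval f a ^ n"
  by (induction n) simp_all

lemma point_eval_poly: "point_eval (poly F x) a = poly (map_poly (\<lambda>f. point_eval f a) F) (point_eval x a)"
  by (induction F) (simp_all add: map_poly_pCons)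

lemma radial_const_arith:
  "radial_const c - radial_const d = radial_const (c - d)"
  "radial_const c * radial_const d = radial_const (c * d)"
  "radial_const 1 = 1" "radial_const 0 = 0"
  by (auto intro!: radial_fun_eqI)

lemma subring_coord_ring: "is_subring (coord_ring n)"
proof (induction n)
  case 0
  show ?case
    by (auto simp: is_subring_def radial_const_arith) (metis radial_const_arith(3) rangeI)
next
  case (Suc n)
  then show ?case
    by (simp add: subring_adjoin)
qed

lemma coord_ring_mono: "m \<le> n \<Longrightarrow> coord_ring m \<subseteq> coord_ring n"
  by (rule lift_Suc_mono_le[of coord_ring]) (simp_all add: subset_adjoin subring_coord_ring)

lemma radial_const_in_coord_ring: "radial_const c \<in> coord_ring n"
  using coord_ring_mono[of 0 n] by auto

lemma radial_coord_in_coord_ring: "i < n \<Longrightarrow> radial_coord i \<in> coord_ring n"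
  using coord_ring_mono[of "Suc i" n] self_in_adjoin[OF subring_coord_ring, of "radial_coord i" i] by auto

text \<open>This allows coordinate \<open>n\<close> of a point to be chosen after the earlier ones
  have been fixed.\<close>

lemma coord_ring_cong:
  assumes "f \<in> coord_ring n" "\<And>i. i < n \<Longrightarrow> a i = b i"
  shows "expansion f a = expansion f b"
  using assms
proof (induction n arbitrary: f)
  case 0
  then show ?case
    by auto
next
  case (Suc n)
  then obtain F where F: "F \<in> polys_over (coord_ring n)" and f: "f = poly F (radial_coord n)"
    by (auto simp: adjoin_def)
  from F have "expansion (poly F (radial_coord n)) a = expansion (poly F (radial_coord n)) b"
  proof (induction F)
    case (pCons c F)
    then have "c \<in> coord_ring n" "F \<in> polys_over (coord_ring n)"
      by (simp_all add: polys_over_pCons)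
    then show ?case
      using pCons.IH Suc.IH[of c] Suc.prems(2) by simp
  qed simp
  then show ?case
    by (simp add: f)
qed

lemma point_eval_polys_over_eq_0:
  assumes "R \<in> polys_over P" "\<And>f. f \<in> P \<Longrightarrow> point_eval f a = 0"
  shows "map_poly (\<lambda>f. point_eval f a) R = 0"
  by (rule poly_eqI) (use assms in \<open>simp add: coeff_map_poly polys_over_def\<close>)

text \<open>
  Hilbert's Nullstellensatz for prime ideals: the zero is built coordinate by coordinate, the new
  coordinate being generic or a root of a relation of minimal degree.
\<close>

lemma prime_ideal_zero:
  fixes P :: "'k::alg_closed_field radial_fun set"
  assumes "is_prime_ideal (coord_ring n) P" "h \<in> coord_ring n" "h \<notin> P"
  shows "\<exists>a. (\<forall>f\<in>P. point_eval f a = 0) \<and> point_eval h a \<noteq> 0"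
  using assms
proof (induction n arbitrary: P h)
  case 0
  have P: "is_ideal (range radial_const) P" "1 \<notin> P"
    using 0 by (auto simp: is_prime_ideal_def)
  \<comment> \<open>The ring is the field of constants, whose only prime ideal is zero.\<close>
  have "c = 0" if "radial_const c \<in> P" for c
  proof (rule ccontr)
    assume "c \<noteq> 0"
    then show False
      using ideal_mult[OF P(1) rangeI that, of "inverse c"] P(2) by (simp add: radial_const_arith)
  qed
  then have "\<forall>f\<in>P. f = 0"
    using ideal_subset[OF P(1)] by (metis imageE radial_const_arith(4))
  moreover have "h \<noteq> 0"
    using 0 ideal_0[OF P(1)] by auto
  then have "point_eval h a \<noteq> 0" for a
    using 0 by (auto simp: radial_const_arith)
  ultimately show ?case
    by (metis point_eval_simps(1))
next
  case (Suc n)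
  let ?S = "coord_ring n" and ?x = "radial_coord n :: 'k radial_fun"
  have S: "is_subring ?S"
    by (rule subring_coord_ring)
  have P: "is_prime_ideal (adjoin ?S ?x) P" and h: "h \<in> adjoin ?S ?x"
    using Suc.prems by simp_all
  have PS: "is_prime_ideal ?S (P \<inter> ?S)"
    using prime_ideal_inter_subring[OF S subset_adjoin[OF S] P] .
  have local: "point_eval f (a(n := \<xi>)) = point_eval f a" if "f \<in> ?S" for f a \<xi>
    using coord_ring_cong[OF that, of "a(n := \<xi>)" a] by (simp add: point_eval_def)
  have eval: "point_eval (poly F ?x) (a(n := \<xi>)) = poly (map_poly (\<lambda>f. point_eval f a) F) \<xi>"
    if "F \<in> polys_over ?S" for F a \<xi>
  proof -
    have "map_poly (\<lambda>f. point_eval f (a(n := \<xi>))) F = map_poly (\<lambda>f. point_eval f a) F"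
      by (rule poly_eqI) (simp add: coeff_map_poly local polys_overD[OF that])
    then show ?thesis
      by (simp add: point_eval_poly)
  qed
  show ?case
  proof (cases "\<exists>F\<in>polys_over ?S. poly F ?x \<in> P \<and> (\<exists>i. coeff F i \<notin> P)")
    case True
    then obtain F\<^sub>0 i\<^sub>0 where F\<^sub>0: "F\<^sub>0 \<in> polys_over ?S" "poly F\<^sub>0 ?x \<in> P" "coeff F\<^sub>0 i\<^sub>0 \<notin> P"
      by blast
    obtain F where F: "F \<in> polys_over ?S" "poly F ?x \<in> P" "lead_coeff F \<notin> P" "0 < degree F"
      and divide: "\<And>H. H \<in> polys_over ?S \<Longrightarrow> poly H ?x \<in> P \<Longrightarrow>
        \<exists>N. \<exists>Q\<in>polys_over ?S. \<exists>R\<in>polys_over P. smult (lead_coeff F ^ N) H = Q * F + R"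
      and norm: "\<And>h. h \<in> adjoin ?S ?x \<Longrightarrow> h \<notin> P \<Longrightarrow>
        \<exists>a\<in>?S. a \<notin> P \<and> (\<exists>u\<in>adjoin ?S ?x. a - u * h \<in> P)"
      by (rule algebraic_adjoin[OF S P F\<^sub>0]) (rule that; (assumption | blast))
    let ?c = "lead_coeff F"
    \<comment> \<open>\<open>c'\<close> lies in the smaller ring and is a multiple of
      \<open>h\<close> modulo \<open>P\<close>, so at a zero of \<open>P\<close> its nonvanishing
      implies that of \<open>h\<close>.\<close>
    obtain c' u where c': "c' \<in> ?S" "c' \<notin> P" and u: "c' - u * h \<in> P"
      using norm[OF h Suc.prems(3)] by blast
    have c: "?c \<in> ?S"
      using F(1) by (rule polys_overD)
    have "?c * c' \<notin> P \<inter> ?S"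
      using prime_ideal_cases[OF PS c c'(1)] F(3) c'(2) by blast
    then obtain a where a: "\<And>f. f \<in> P \<inter> ?S \<Longrightarrow> point_eval f a = 0" and ca: "point_eval (?c * c') a \<noteq> 0"
      using Suc.IH[OF PS subring_mult[OF S c c'(1)]] by blast
    have c0: "point_eval ?c a \<noteq> 0" and c'0: "point_eval c' a \<noteq> 0"
      using ca by auto
    let ?ev = "map_poly (\<lambda>f. point_eval f a)"
    \<comment> \<open>The leading coefficient survives evaluation at \<open>a\<close>, so the
      specialized relation still has positive degree and a root.\<close>
    have "degree (?ev F) = degree F"
      using c0 by (intro map_poly_degree_eq) simp_all
    then obtain \<xi> where \<xi>: "poly (?ev F) \<xi> = 0"
      using alg_closed_imp_poly_has_root[of "?ev F"] F(4) by auto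
    let ?b = "a(n := \<xi>)"
    have zero: "point_eval f ?b = 0" if f: "f \<in> P" for f
    proof -
      obtain H where H: "H \<in> polys_over ?S" "f = poly H ?x"
        using ideal_subset[OF prime_ideal_ideal[OF P] f] by (auto simp: adjoin_def)
      with f have "poly H ?x \<in> P"
        by simp
      \<comment> \<open>Pseudo-division reduces the vanishing of \<open>f\<close> to that of
        \<open>F\<close> at \<open>?b\<close> and of the coefficients of \<open>R\<close> at
        \<open>a\<close>, the factor \<open>?c ^ N\<close> being nonzero there.\<close>
      from divide[OF H(1) this] obtain N Q R where Q: "Q \<in> polys_over ?S" and R: "R \<in> polys_over P"
        and eq: "smult (?c ^ N) H = Q * F + R"
        by blast
      have "R = smult (?c ^ N) H - Q * F"
        by (simp add: eq)
      then have RS: "R \<in> polys_over ?S"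
        using H(1) Q F(1) c by (simp add: polys_over_diff polys_over_smult polys_over_mult subring_power S)
      with R have "R \<in> polys_over (P \<inter> ?S)"
        by (simp add: polys_over_def)
      then have "?ev R = 0"
        using a by (rule point_eval_polys_over_eq_0)
      then have "point_eval (poly R ?x) ?b = 0"
        using eval[OF RS] by simp
      moreover have "point_eval (poly F ?x) ?b = 0"
        using eval[OF F(1)] \<xi> by simp
      moreover have "poly (smult (?c ^ N) H) ?x = poly (Q * F + R) ?x"
        by (simp only: eq)
      then have "point_eval (?c ^ N * poly H ?x) ?b = point_eval (poly Q ?x * poly F ?x + poly R ?x) ?b"
        by simp
      ultimately show ?thesis
        using c0 local[OF c] H(2) by simp
    qed
    moreover have "point_eval h ?b \<noteq> 0"
      using zero[OF u] c'0 local[OF c'(1)] by auto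
    ultimately show ?thesis
      by blast
  next
    case False
    \<comment> \<open>Here any polynomial over \<open>?S\<close> with value in \<open>P\<close> has
      its coefficients in \<open>P\<close>, and these vanish at \<open>a\<close> whatever the new
      coordinate is; only the finitely many roots of the specialized \<open>G\<close> must be
      avoided.\<close>
    obtain G where G: "G \<in> polys_over ?S" "h = poly G ?x"
      using h by (auto simp: adjoin_def)
    have "G \<notin> polys_over P"
      using poly_in_ideal[OF subring_adjoin[OF S] prime_ideal_ideal[OF P] self_in_adjoin[OF S]] G(2)
        Suc.prems(3) by blast
    then obtain i where i: "coeff G i \<notin> P"
      by (auto simp: polys_over_def)
    then obtain a where a: "\<And>f. f \<in> P \<inter> ?S \<Longrightarrow> point_eval f a = 0" and ai: "point_eval (coeff G i) a \<noteq> 0"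
      using Suc.IH[OF PS polys_overD[OF G(1)], of i] by blast
    let ?ev = "map_poly (\<lambda>f. point_eval f a)"
    have "coeff (?ev G) i \<noteq> 0"
      using ai by (simp add: coeff_map_poly)
    then have "?ev G \<noteq> 0"
      by auto
    then have "finite {\<xi>. poly (?ev G) \<xi> = 0}"
      by (rule poly_roots_finite)
    then obtain \<xi> where \<xi>: "poly (?ev G) \<xi> \<noteq> 0"
      using infinite_UNIV_alg_closed[where 'k = 'k] by (metis (mono_tags, lifting) UNIV_eq_I mem_Collect_eq)
    have "point_eval f (a(n := \<xi>)) = 0" if f: "f \<in> P" for f
    proof -
      obtain H where H: "H \<in> polys_over ?S" "f = poly H ?x"
        using ideal_subset[OF prime_ideal_ideal[OF P] f] by (auto simp: adjoin_def)
      then have "H \<in> polys_over (P \<inter> ?S)"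
        using False f by (auto simp: polys_over_def)
      then have "?ev H = 0"
        using a by (rule point_eval_polys_over_eq_0)
      then show ?thesis
        using eval[OF H(1)] H(2) by simp
    qed
    moreover have "point_eval h (a(n := \<xi>)) \<noteq> 0"
      using eval[OF G(1)] G(2) \<xi> by simp
    ultimately show ?thesis
      by blast
  qed
qed

section \<open>Systems with more unknowns than equations\<close>

text \<open>Order of vanishing at the origin at least \<open>N\<close>, measured along every line
  through it; these sets stand in for the powers of the maximal ideal there.\<close>

definition vanishing :: "nat \<Rightarrow> 'k::field radial_fun set" where
  "vanishing N = {f. \<forall>a. monom 1 N dvd expansion f a}"

lemma vanishing_0 [simp]: "vanishing 0 = UNIV"
  by (auto simp: vanishing_def)

lemma vanishing_add: "f \<in> vanishing N \<Longrightarrow> g \<in> vanishing N \<Longrightarrow> f + g \<in> vanishing N"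
  and vanishing_mult_left: "f \<in> vanishing N \<Longrightarrow> h * f \<in> vanishing N"
  and zero_in_vanishing: "0 \<in> vanishing N"
  and vanishing_uminus: "f \<in> vanishing N \<Longrightarrow> - f \<in> vanishing N"
  by (auto simp: vanishing_def intro: dvd_mult)

lemma vanishing_mult: "f \<in> vanishing M \<Longrightarrow> g \<in> vanishing N \<Longrightarrow> f * g \<in> vanishing (M + N)"
  using mult_dvd_mono[of "monom 1 M" _ "monom (1 :: 'a) N"] by (auto simp: vanishing_def mult_monom)

lemma vanishing_power: "f \<in> vanishing M \<Longrightarrow> f ^ k \<in> vanishing (k * M)"
  by (induction k) (auto intro: vanishing_mult)

lemma vanishing_prod: "(\<And>i. i \<in> A \<Longrightarrow> f i \<in> vanishing (M i)) \<Longrightarrow> prod f A \<in> vanishing (sum M A)"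
  by (induction A rule: infinite_finite_induct) (auto intro: vanishing_mult)

lemma vanishing_mono:
  assumes "f \<in> vanishing N" "M \<le> N"
  shows "f \<in> vanishing M"
proof -
  have "monom 1 M dvd monom (1 :: 'a) N"
    using assms(2) by (simp add: monom_1_dvd_iff')
  then show ?thesis
    using assms(1) dvd_trans by (auto simp: vanishing_def)
qed

interpretation radial: vector_space "\<lambda>c f. radial_const c * f :: 'k::field radial_fun"
  by unfold_locales (auto intro!: radial_fun_eqI simp: algebra_simps smult_add_left)

lemma radial_subspace_ideal: "is_ideal (coord_ring n) I \<Longrightarrow> radial.subspace I"
  by (auto simp: radial.subspace_def is_ideal_def radial_const_in_coord_ring)

lemma radial_subspace_vanishing: "radial.subspace (vanishing N)"
  by (auto simp: radial.subspace_def zero_in_vanishing intro: vanishing_add vanishing_mult_left)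

text \<open>The function 1 - G / g vanishes at the origin, so the geometric series for the inverse
  of G / g can be cut off after \<open>N\<close> terms.\<close>

lemma inverse_modulo_vanishing:
  assumes G: "G \<in> coord_ring n" and g: "g \<noteq> 0" "\<And>a. poly (expansion G a) 0 = g"
  shows "\<exists>U\<in>coord_ring n. G * U - 1 \<in> vanishing N"
proof -
  note S = subring_coord_ring[of n]
  define G' where "G' = radial_const (inverse g) * G"
  define w where "w = 1 - G'"
  define U where "U = radial_const (inverse g) * (\<Sum>k<N. w ^ k)"
  have w: "w \<in> coord_ring n"
    unfolding w_def G'_def using G by (intro subring_diff subring_mult subring_1 S radial_const_in_coord_ring)
  have "w \<in> vanishing 1"
    using g by (auto simp: vanishing_def w_def G'_def monom_1_dvd_iff' poly_0_coeff_0[symmetric])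
  then have "w ^ N \<in> vanishing N"
    using vanishing_power[of w 1 N] by simp
  moreover have "G * U - 1 = - (w ^ N)"
  proof -
    have "G * U = (1 - w) * (\<Sum>k<N. w ^ k)"
      by (simp add: U_def w_def G'_def mult_ac)
    also have "\<dots> = 1 - w ^ N"
      by (rule one_diff_power_eq[symmetric])
    finally show ?thesis
      by simp
  qed
  moreover have "U \<in> coord_ring n"
    unfolding U_def using w by (intro subring_mult subring_sum subring_power S radial_const_in_coord_ring)
  ultimately show ?thesis
    by (metis vanishing_uminus)
qed

section \<open>Monomials, truncation and linear independence\<close>

definition coord_monom :: "nat \<Rightarrow> (nat \<Rightarrow> nat) \<Rightarrow> 'k::field radial_fun" where
  "coord_monom n e = (\<Prod>i<n. radial_coord i ^ e i)"

lemma coord_monom_cong: "(\<And>i. i < n \<Longrightarrow> e i = e' i) \<Longrightarrow> coord_monom n e = coord_monom n e'"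
  by (simp add: coord_monom_def)

lemma coord_monom_in_coord_ring: "coord_monom n e \<in> coord_ring n"
  unfolding coord_monom_def
  by (intro subring_prod subring_power subring_coord_ring radial_coord_in_coord_ring) simp

lemma expansion_coord_monom:
  "expansion (coord_monom n e) a = monom (\<Prod>i<n. a i ^ e i) (\<Sum>i<n. e i)"
proof -
  have "[:0, a i:] ^ k = monom (a i ^ k) k" for i k
  proof -
    have "[:0, a i:] = monom (a i) 1"
      by (simp add: monom_altdef)
    then show ?thesis
      by (simp add: monom_power)
  qed
  then show ?thesis
    unfolding coord_monom_def expansion_prod by (induction n) (simp_all add: mult_monom)
qed

lemma coord_ring_subset_span:
  fixes f :: "'k::field radial_fun"
  shows "f \<in> coord_ring n \<Longrightarrow> f \<in> radial.span (range (coord_monom n))"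
proof (induction n arbitrary: f)
  case 0
  then obtain c where "f = radial_const c * coord_monom 0 (\<lambda>_. 0)"
    by (auto simp: coord_monom_def)
  then show ?case
    by (auto intro: radial.span_scale radial.span_base)
next
  case (Suc n)
  let ?x = "radial_coord n :: 'k radial_fun"
  have mult: "g * ?x ^ i \<in> radial.span (range (coord_monom (Suc n)))"
    if "g \<in> radial.span (range (coord_monom n))" for g :: "'k radial_fun" and i
    using that
  proof (rule radial.span_induct)
    show "radial.subspace {g. g * ?x ^ i \<in> radial.span (range (coord_monom (Suc n)))}"
      by (auto simp: radial.subspace_def distrib_right mult.assoc radial.span_zero
          intro: radial.span_add radial.span_scale)
    fix g :: "'k radial_fun"
    assume "g \<in> range (coord_monom n)"
    then obtain e where "g = coord_monom n e"
      by auto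
    moreover have "coord_monom n e = coord_monom n (e(n := i))"
      by (rule coord_monom_cong) simp
    ultimately have "g * ?x ^ i = coord_monom (Suc n) (e(n := i))"
      by (simp add: coord_monom_def)
    then show "g * ?x ^ i \<in> radial.span (range (coord_monom (Suc n)))"
      by (auto intro: radial.span_base)
  qed
  obtain F where F: "F \<in> polys_over (coord_ring n)" "f = poly F ?x"
    using Suc.prems by (auto simp: adjoin_def)
  then show ?case
    by (simp add: poly_altdef) (intro radial.span_sum mult Suc.IH polys_overD)
qed

text \<open>A linear map that kills \<open>vanishing N\<close> and fixes the monomials of degree
  below \<open>N\<close>; it turns congruences modulo \<open>vanishing N\<close> into statements
  about spans of finite sets.\<close>

definition truncate :: "nat \<Rightarrow> 'k::field radial_fun \<Rightarrow> 'k radial_fun" where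
  "truncate N f = Radial_Fun (\<lambda>a. poly_cutoff N (expansion f a))"

lemma expansion_truncate: "expansion (truncate N f) a = poly_cutoff N (expansion f a)"
  by (simp add: truncate_def Radial_Fun_inverse)

lemma truncate_add: "truncate N (f + g) = truncate N f + truncate N g"
  and truncate_scale: "truncate N (radial_const c * f) = radial_const c * truncate N f"
  by (auto intro!: radial_fun_eqI poly_eqI simp: expansion_truncate coeff_poly_cutoff)

lemma truncate_vanishing: "f \<in> vanishing N \<Longrightarrow> truncate N f = 0"
  by (auto intro!: radial_fun_eqI poly_eqI
      simp: expansion_truncate coeff_poly_cutoff vanishing_def monom_1_dvd_iff')

lemma truncate_coord_monom: "(\<Sum>i<n. e i) < N \<Longrightarrow> truncate N (coord_monom n e) = coord_monom n e"
  by (auto intro!: radial_fun_eqI poly_eqI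
      simp: expansion_truncate coeff_poly_cutoff expansion_coord_monom coeff_monom)

lemma truncate_span:
  fixes f :: "'k::field radial_fun"
  assumes "f \<in> radial.span B"
  shows "truncate N f \<in> radial.span (truncate N ` B)"
  using assms
proof (rule radial.span_induct)
  have "truncate N (0 :: 'k radial_fun) = 0"
    by (rule truncate_vanishing[OF zero_in_vanishing])
  then show "radial.subspace {f. truncate N f \<in> radial.span (truncate N ` B)}"
    by (auto simp: radial.subspace_def truncate_add truncate_scale radial.span_zero
        intro: radial.span_add radial.span_scale)
qed (auto intro: radial.span_base)

lemma sum_digits: "(\<Sum>i<n. (c div L ^ i mod L) * L ^ i) = c mod L ^ n" for c L :: nat
proof (induction n)
  case (Suc n)
  have "c mod L ^ Suc n = L ^ n * (c div L ^ n mod L) + c mod L ^ n"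
    by (simp add: mod_mult2_eq mult.commute[of L])
  then show ?case
    using Suc by (simp add: mult.commute)
qed simp

lemma poly_eq_infiniteI:
  fixes p q :: "'k::idom poly"
  assumes "infinite (UNIV :: 'k set)" "\<And>x. poly p x = poly q x"
  shows "p = q"
  using assms poly_roots_finite[of "p - q"] by auto

text \<open>
  Kronecker's substitution \<open>a\<^sub>i = t\<^bsup>L\<^sup>i\<^esup>\<close> sends the monomial whose exponents are the digits of \<open>c\<close> in
  base \<open>L\<close> to \<open>t\<^sup>c\<close>, which reduces linear independence to one variable.
\<close>

lemma independent_coord_monoms:
  fixes L n :: nat
  assumes inf: "infinite (UNIV :: 'k::field set)"
  defines "M \<equiv> (\<lambda>c. coord_monom n (\<lambda>i. c div L ^ i mod L) :: 'k radial_fun)"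
  shows "radial.independent (M ` {..<L ^ n})" "inj_on M {..<L ^ n}"
proof -
  define pt where "pt t = (\<lambda>i. t ^ L ^ i :: 'k)" for t
  have ev: "point_eval (M c) (pt t) = t ^ c" if "c < L ^ n" for c t
  proof -
    have "point_eval (M c) (pt t) = (\<Prod>i<n. t ^ ((c div L ^ i mod L) * L ^ i))"
      by (simp add: point_eval_def M_def expansion_coord_monom poly_monom pt_def mult.commute
          flip: power_mult)
    also have "\<dots> = t ^ (\<Sum>i<n. (c div L ^ i mod L) * L ^ i)"
      by (simp add: power_sum)
    finally show ?thesis
      using that by (simp add: sum_digits)
  qed
  show inj: "inj_on M {..<L ^ n}"
  proof (rule inj_onI)
    fix c d
    assume cd: "c \<in> {..<L ^ n}" "d \<in> {..<L ^ n}" "M c = M d"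
    have "monom (1 :: 'k) c = monom 1 d"
    proof (rule poly_eq_infiniteI[OF inf])
      show "poly (monom 1 c) t = poly (monom 1 d) t" for t :: 'k
        using ev[of c t] ev[of d t] cd by (simp add: poly_monom)
    qed
    then show "c = d"
      by (simp add: monom_eq_iff')
  qed
  show "radial.independent (M ` {..<L ^ n})"
  proof (rule radial.independent_if_scalars_zero)
    fix u f
    assume sum: "(\<Sum>x\<in>M ` {..<L ^ n}. radial_const (u x) * x) = 0" and f: "f \<in> M ` {..<L ^ n}"
    \<comment> \<open>Evaluated at \<open>pt t\<close>, the linear relation becomes the polynomial
      \<open>p\<close>, whose coefficient at \<open>c\<close> is the scalar attached to
      \<open>M c\<close>.\<close>
    define p where "p = (\<Sum>c<L ^ n. monom (u (M c)) c)"
    have "p = 0"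
    proof (rule poly_eq_infiniteI[OF inf])
      fix t :: 'k
      have "(\<Sum>c<L ^ n. radial_const (u (M c)) * M c) = 0"
        using sum inj by (simp add: sum.reindex)
      then have "point_eval (\<Sum>c<L ^ n. radial_const (u (M c)) * M c) (pt t) = 0"
        by simp
      then have "(\<Sum>c<L ^ n. point_eval (radial_const (u (M c)) * M c) (pt t)) = 0"
        by (simp add: point_eval_def expansion_sum poly_sum)
      then show "poly p t = poly 0 t"
        by (simp add: p_def poly_sum poly_monom ev)
    qed
    obtain d where d: "d < L ^ n" "f = M d"
      using f by auto
    have "coeff p d = u f"
      using d by (simp add: p_def coeff_sum coeff_monom)
    with \<open>p = 0\<close> show "u f = 0"
      by simp
  qed simp
qed

definition generated_ideal :: "nat \<Rightarrow> 'k::field radial_fun set \<Rightarrow> 'k radial_fun set" where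
  "generated_ideal n Fs = {\<Sum>f\<in>Fs. q f * f |q. \<forall>f\<in>Fs. q f \<in> coord_ring n}"

lemma is_ideal_generated_ideal:
  fixes Fs :: "'k::field radial_fun set"
  assumes Fs: "Fs \<subseteq> coord_ring n"
  shows "is_ideal (coord_ring n) (generated_ideal n Fs)"
  unfolding is_ideal_def
proof (intro conjI ballI)
  note S = subring_coord_ring[of n, where 'a = 'k]
  show "generated_ideal n Fs \<subseteq> coord_ring n"
    using Fs by (auto simp: generated_ideal_def intro!: subring_sum subring_mult S)
  have "0 = (\<Sum>f\<in>Fs. 0 * f)"
    by simp
  then show "0 \<in> generated_ideal n Fs"
    unfolding generated_ideal_def using subring_0[OF S] by (intro CollectI exI[of _ "\<lambda>_. 0"]) simp
  fix x y :: "'k radial_fun"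
  assume "y \<in> generated_ideal n Fs"
  then obtain q where q: "y = (\<Sum>f\<in>Fs. q f * f)" "\<forall>f\<in>Fs. q f \<in> coord_ring n"
    by (auto simp: generated_ideal_def)
  {
    assume "x \<in> generated_ideal n Fs"
    then obtain r where r: "x = (\<Sum>f\<in>Fs. r f * f)" "\<forall>f\<in>Fs. r f \<in> coord_ring n"
      by (auto simp: generated_ideal_def)
    then have "x + y = (\<Sum>f\<in>Fs. (r f + q f) * f)"
      by (simp add: q sum.distrib distrib_right)
    then show "x + y \<in> generated_ideal n Fs"
      unfolding generated_ideal_def using q(2) r(2) subring_add[OF S]
      by (intro CollectI exI[of _ "\<lambda>f. r f + q f"]) simp
  }
  assume "x \<in> coord_ring n"
  moreover have "x * y = (\<Sum>f\<in>Fs. (x * q f) * f)"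
    by (simp add: q sum_distrib_left mult.assoc)
  ultimately show "x * y \<in> generated_ideal n Fs"
    unfolding generated_ideal_def using q(2) subring_mult[OF S]
    by (intro CollectI exI[of _ "\<lambda>f. x * q f"]) simp
qed

lemma generator_in_generated_ideal:
  fixes f :: "'k::field radial_fun"
  assumes "finite Fs" "f \<in> Fs"
  shows "f \<in> generated_ideal n Fs"
proof -
  have "f = (\<Sum>g\<in>Fs. (if g = f then 1 else 0) * g)"
    using assms by (simp add: if_distrib[of "\<lambda>c. c * _"] cong: if_cong)
  then show ?thesis
    unfolding generated_ideal_def using subring_0 subring_1 subring_coord_ring
    by (intro CollectI exI[of _ "\<lambda>g. if g = f then 1 else 0"]) auto
qed

text \<open>
  Krull's height theorem at the origin, by counting: if every \<open>x\<^sub>i\<close> were nilpotent in the local ring modulo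
  fewer than \<open>n\<close> functions \<open>f\<close>, all polynomials would be, modulo high order, combinations of
  products of powers of the \<open>f\<close> with boundedly many monomials, and there are too few of these.
\<close>

lemma coord_not_nilpotent:
  fixes Fs :: "'k::field radial_fun set"
  assumes inf: "infinite (UNIV :: 'k set)"
    and fin: "finite Fs" and Fs: "Fs \<subseteq> coord_ring n" and card: "card Fs < n"
    and zero: "Fs \<subseteq> vanishing 1"
    and G: "G \<in> coord_ring n" and g: "g \<noteq> 0" "\<And>a. poly (expansion G a) 0 = g"
  shows "\<exists>i<n. \<forall>k. (radial_coord i * G) ^ k \<notin> generated_ideal n Fs"
proof (rule ccontr)
  let ?I = "generated_ideal n Fs" and ?S = "coord_ring n :: 'k radial_fun set"
  let ?x = "radial_coord :: nat \<Rightarrow> 'k radial_fun"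
  note S = subring_coord_ring[of n, where 'a = 'k]
  have I: "is_ideal ?S ?I"
    using Fs by (rule is_ideal_generated_ideal)
  assume "\<not> ?thesis"
  then obtain M\<^sub>0 where M\<^sub>0: "\<And>i. i < n \<Longrightarrow> (?x i * G) ^ M\<^sub>0 i \<in> ?I"
    by metis
  \<comment> \<open>A common exponent for all coordinates: the sum bounds each of its terms.\<close>
  define M where "M = (\<Sum>i<n. M\<^sub>0 i)"
  have M: "(?x i * G) ^ M \<in> ?I" if "i < n" for i
  proof -
    have "M\<^sub>0 i \<le> M"
      unfolding M_def using that by (intro member_le_sum) auto
    then have "(?x i * G) ^ M = (?x i * G) ^ (M - M\<^sub>0 i) * (?x i * G) ^ M\<^sub>0 i"
      by (simp flip: power_add)
    then show ?thesis
      using that G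
      by (auto intro!: ideal_mult[OF I _ M\<^sub>0] subring_power[OF S] subring_mult[OF S] radial_coord_in_coord_ring)
  qed
  define r where "r = card Fs"
  \<comment> \<open>The constants serve the final count: \<open>L\<close> exceeds
    \<open>(n + 1) ^ r * M ^ n\<close>, while \<open>N\<close> exceeds the degree of every monomial
    with exponents below \<open>L\<close> and is at most \<open>(n + 1) * L\<close>.\<close>
  define L where "L = (n + 1) ^ r * M ^ n + 1"
  define N where "N = n * L + 1"
  define Box where "Box = ({..<n} \<rightarrow>\<^sub>E {..<M})"
  define V where "V = (coord_monom n :: _ \<Rightarrow> 'k radial_fun) ` Box"
  \<comment> \<open>These at most \<open>N ^ r * M ^ n\<close> products will span \<open>?S\<close>
    modulo \<open>vanishing N\<close>.\<close>
  define B where "B = (\<lambda>(\<beta>, e). (\<Prod>f\<in>Fs. f ^ \<beta> f) * coord_monom n e) ` ((Fs \<rightarrow>\<^sub>E {..<N}) \<times> Box)"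
  have finBox: "finite Box" "card Box = M ^ n"
    by (simp_all add: Box_def finite_PiE card_PiE)
  have finB: "finite B" and cardB: "card B \<le> N ^ r * M ^ n"
  proof -
    have fin2: "finite ((Fs \<rightarrow>\<^sub>E {..<N}) \<times> Box)"
      using fin finBox by (simp add: finite_PiE)
    then show "finite B"
      by (simp add: B_def)
    have "card B \<le> card ((Fs \<rightarrow>\<^sub>E {..<N}) \<times> Box)"
      unfolding B_def by (rule card_image_le[OF fin2])
    also have "\<dots> = N ^ r * M ^ n"
      using fin by (simp add: card_cartesian_product finBox card_PiE r_def)
    finally show "card B \<le> N ^ r * M ^ n" .
  qed
  \<comment> \<open>Modulo \<open>?I\<close> and functions of order \<open>N\<close>, only the
    monomials with all exponents below \<open>M\<close> remain.\<close>
  have split: "\<exists>v\<in>radial.span V. \<exists>u\<in>?I. \<exists>w\<in>vanishing N. f = v + u + w" if f: "f \<in> ?S" for f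
  proof -
    define D where "D = {y + w |y w. y \<in> {v + u |v u. v \<in> radial.span V \<and> u \<in> ?I} \<and> w \<in> vanishing N}"
    have "radial.subspace D"
      unfolding D_def
      by (intro radial.subspace_sums radial.subspace_span radial_subspace_ideal[OF I] radial_subspace_vanishing)
    moreover have "coord_monom n e \<in> D" for e
    proof (cases "\<forall>i<n. e i < M")
      case True
      have "coord_monom n e = coord_monom n (restrict e {..<n})"
        by (rule coord_monom_cong) simp
      also have "\<dots> \<in> V"
        using True by (auto simp: V_def Box_def)
      finally have "coord_monom n e + 0 + 0 \<in> D"
        unfolding D_def using ideal_0[OF I] zero_in_vanishing[of N] by (blast intro: radial.span_base)
      then show ?thesis
        by simp
    next
      case False
      then obtain i where i: "i < n" "M \<le> e i"
        by (auto simp: not_less)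
      define R :: "'k radial_fun" where "R = coord_monom n (e(i := e i - M))"
      have "coord_monom n e = ?x i ^ M * (?x i ^ (e i - M) * (\<Prod>j\<in>{..<n} - {i}. ?x j ^ e j))"
        unfolding coord_monom_def using i by (subst prod.remove[of _ i]) (auto simp flip: power_add mult.assoc)
      also have "?x i ^ (e i - M) * (\<Prod>j\<in>{..<n} - {i}. ?x j ^ e j) = R"
        unfolding R_def coord_monom_def using i by (subst (2) prod.remove[of _ i]) auto
      finally have e: "coord_monom n e = ?x i ^ M * R" .
      \<comment> \<open>\<open>G\<close> is invertible modulo \<open>vanishing N\<close>, so it can
        be divided out of \<open>(?x i * G) ^ M\<close>: a monomial divisible by
        \<open>?x i ^ M\<close> lies in \<open>?I\<close> up to order \<open>N\<close>.\<close>
      have "G ^ M \<in> ?S" "g ^ M \<noteq> 0" "\<And>a. poly (expansion (G ^ M) a) 0 = g ^ M"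
        using G g subring_power[OF S] by simp_all
      then obtain U where U: "U \<in> ?S" "G ^ M * U - 1 \<in> vanishing N"
        using inverse_modulo_vanishing[of "G ^ M" n "g ^ M" N] by blast
      have "coord_monom n e = 0 + (R * U) * (?x i * G) ^ M + - (R * ?x i ^ M) * (G ^ M * U - 1)"
        by (simp add: e algebra_simps power_mult_distrib)
      moreover have "(R * U) * (?x i * G) ^ M \<in> ?I"
        using U(1) M[OF i(1)] unfolding R_def
        by (intro ideal_mult[OF I] subring_mult[OF S] coord_monom_in_coord_ring)
      moreover have "- (R * ?x i ^ M) * (G ^ M * U - 1) \<in> vanishing N"
        by (rule vanishing_mult_left[OF U(2)])
      ultimately show ?thesis
        unfolding D_def using radial.span_zero[of V] by blast
    qed
    then have "range (coord_monom n) \<subseteq> D"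
      by auto
    ultimately have "radial.span (range (coord_monom n)) \<subseteq> D"
      by (intro radial.span_minimal)
    then have "f \<in> D"
      using coord_ring_subset_span[OF f] by blast
    then show ?thesis
      unfolding D_def by blast
  qed
  define W where "W = {b + w |b w. b \<in> radial.span B \<and> w \<in> vanishing N}"
  have W: "radial.subspace W"
    unfolding W_def by (intro radial.subspace_sums radial.subspace_span radial_subspace_vanishing)
  have W_span: "b \<in> W" if "b \<in> radial.span B" for b
  proof -
    have "b + 0 \<in> W"
      unfolding W_def using that zero_in_vanishing by blast
    then show ?thesis
      by simp
  qed
  have W_van: "w \<in> W" if "w \<in> vanishing N" for w
  proof -
    have "0 + w \<in> W"
      unfolding W_def using that radial.span_zero by blast
    then show ?thesis
      by simp
  qed
  \<comment> \<open>Each use of \<open>split\<close> leaves a combination of elements of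
    \<open>B\<close>, a function of order \<open>N\<close>, and products with one more factor from
    \<open>Fs\<close>. A product of \<open>N\<close> such factors has order \<open>N\<close> itself;
    \<open>k\<close> bounds the number still missing.\<close>
  have prod_in_W: "(\<Prod>f\<in>Fs. f ^ \<beta> f) * q \<in> W" if "q \<in> ?S" "N - sum \<beta> Fs \<le> k" for \<beta> q k
    using that
  proof (induction k arbitrary: \<beta> q)
    case 0
    have "f ^ \<beta> f \<in> vanishing (\<beta> f)" if "f \<in> Fs" for f
      using vanishing_power[of f 1 "\<beta> f"] zero that by auto
    then have "(\<Prod>f\<in>Fs. f ^ \<beta> f) \<in> vanishing (sum \<beta> Fs)"
      by (rule vanishing_prod)
    then have "(\<Prod>f\<in>Fs. f ^ \<beta> f) \<in> vanishing N"
      by (rule vanishing_mono) (use 0 in simp)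
    then have "q * (\<Prod>f\<in>Fs. f ^ \<beta> f) \<in> vanishing N"
      by (rule vanishing_mult_left)
    then show ?case
      by (simp add: W_van mult.commute)
  next
    case (Suc k)
    show ?case
    proof (cases "N \<le> sum \<beta> Fs")
      case True
      then show ?thesis
        by (intro Suc.IH Suc.prems) simp
    next
      case False
      let ?\<Pi> = "\<Prod>f\<in>Fs. f ^ \<beta> f"
      obtain v u w where v: "v \<in> radial.span V" and u: "u \<in> ?I" and w: "w \<in> vanishing N"
        and q: "q = v + u + w"
        using split[OF Suc.prems(1)] by blast
      have "?\<Pi> * v \<in> radial.span B"
        using v
      proof (rule radial.span_induct)
        show "radial.subspace {v. ?\<Pi> * v \<in> radial.span B}"
          by (auto simp: radial.subspace_def distrib_left radial.span_zero mult.left_commute[of ?\<Pi>]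
              intro: radial.span_add radial.span_scale)
        fix v :: "'k radial_fun"
        assume "v \<in> V"
        then obtain e where e: "e \<in> Box" "v = coord_monom n e"
          by (auto simp: V_def)
        have "\<beta> f < N" if "f \<in> Fs" for f
          using False member_le_sum[OF that, of \<beta>] fin by simp
        then have "restrict \<beta> Fs \<in> Fs \<rightarrow>\<^sub>E {..<N}"
          by auto
        moreover have "?\<Pi> = (\<Prod>f\<in>Fs. f ^ restrict \<beta> Fs f)"
          by (rule prod.cong) auto
        ultimately have "?\<Pi> * v \<in> B"
          unfolding B_def using e by (intro image_eqI[of _ _ "(restrict \<beta> Fs, e)"]) auto
        then show "?\<Pi> * v \<in> radial.span B"
          by (rule radial.span_base)
      qed
      then have 1: "?\<Pi> * v \<in> W"
        by (rule W_span)
      obtain p where p: "u = (\<Sum>f\<in>Fs. p f * f)" "\<forall>f\<in>Fs. p f \<in> ?S"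
        using u by (auto simp: generated_ideal_def)
      have "?\<Pi> * (p f * f) \<in> W" if f: "f \<in> Fs" for f
      proof -
        let ?\<beta>' = "\<beta>(f := \<beta> f + 1)"
        have "(\<Prod>f\<in>Fs. f ^ ?\<beta>' f) = f ^ (\<beta> f + 1) * (\<Prod>h\<in>Fs - {f}. h ^ \<beta> h)"
          using fin f by (subst prod.remove[of _ f]) auto
        moreover have "?\<Pi> = f ^ \<beta> f * (\<Prod>h\<in>Fs - {f}. h ^ \<beta> h)"
          using fin f by (subst prod.remove[of _ f]) auto
        ultimately have "?\<Pi> * (p f * f) = (\<Prod>f\<in>Fs. f ^ ?\<beta>' f) * p f"
          by (simp add: mult_ac)
        moreover have "sum ?\<beta>' Fs = sum \<beta> Fs + 1"
          using fin f sum.remove[of Fs f \<beta>] sum.remove[of Fs f ?\<beta>'] by simp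
        then have "(\<Prod>f\<in>Fs. f ^ ?\<beta>' f) * p f \<in> W"
          using p(2) f Suc.prems(2) by (intro Suc.IH) auto
        ultimately show ?thesis
          by simp
      qed
      then have 2: "?\<Pi> * u \<in> W"
        unfolding p(1) sum_distrib_left by (intro radial.subspace_sum[OF W])
      have 3: "?\<Pi> * w \<in> W"
        using w by (intro W_van vanishing_mult_left)
      show ?thesis
        unfolding q distrib_left by (intro radial.subspace_add[OF W] 1 2 3)
    qed
  qed
  have in_W: "q \<in> W" if "q \<in> ?S" for q
    using prod_in_W[OF that, of "\<lambda>_. 0" N] by simp
  let ?m = "\<lambda>c. coord_monom n (\<lambda>i. c div L ^ i mod L) :: 'k radial_fun"
  have "?m ` {..<L ^ n} \<subseteq> radial.span (truncate N ` B)"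
  proof safe
    fix c
    have "(\<Sum>i<n. c div L ^ i mod L) \<le> (\<Sum>i<n. L)"
      by (intro sum_mono less_imp_le mod_less_divisor) (simp add: L_def)
    then have "(\<Sum>i<n. c div L ^ i mod L) < N"
      by (simp add: N_def)
    then have m: "truncate N (?m c) = ?m c"
      by (rule truncate_coord_monom)
    have "?m c \<in> W"
      by (intro in_W coord_monom_in_coord_ring)
    then obtain b w where "b \<in> radial.span B" "w \<in> vanishing N" "?m c = b + w"
      by (auto simp: W_def)
    then have "truncate N (?m c) \<in> radial.span (truncate N ` B)"
      using truncate_span[of b B N] by (simp add: truncate_add truncate_vanishing)
    then show "?m c \<in> radial.span (truncate N ` B)"
      by (simp only: m)
  qed
  \<comment> \<open>\<open>L ^ n\<close> independent monomials lie in a space spanned by at most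
    \<open>N ^ r * M ^ n\<close> elements; as \<open>r < n\<close>, this contradicts the choice of
    \<open>L\<close>.\<close>
  then have "card (?m ` {..<L ^ n}) \<le> card (truncate N ` B)"
    using radial.independent_span_bound[of "truncate N ` B"] finB independent_coord_monoms(1)[OF inf, where L = L and n = n]
    by blast
  also have "\<dots> \<le> card B"
    by (rule card_image_le[OF finB])
  also have "card (?m ` {..<L ^ n}) = L ^ n"
    by (subst card_image) (auto intro: independent_coord_monoms(2)[OF inf])
  finally have "L ^ n \<le> N ^ r * M ^ n"
    using cardB by simp
  also have "\<dots> \<le> ((n + 1) * L) ^ r * M ^ n"
    by (intro mult_right_mono power_mono) (simp_all add: N_def L_def)
  also have "\<dots> = L ^ r * ((n + 1) ^ r * M ^ n)"
    by (simp only: power_mult_distrib mult_ac)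
  also have "\<dots> < L ^ r * L"
    by (rule mult_strict_left_mono) (simp_all add: L_def)
  also have "\<dots> = L ^ (r + 1)"
    by simp
  also have "\<dots> \<le> L ^ n"
    using card by (intro power_increasing) (simp_all add: L_def r_def)
  finally show False
    by simp
qed

text \<open>Some \<open>radial_coord i * G\<close> has no power in the ideal generated by
  \<open>Fs\<close>. A prime ideal containing \<open>Fs\<close> but not this product has a zero at
  which the product, hence each factor, is nonzero.\<close>

lemma exists_nonzero_common_zero:
  fixes Fs :: "'k::alg_closed_field radial_fun set"
  assumes fin: "finite Fs" and Fs: "Fs \<subseteq> coord_ring n" and card: "card Fs < n"
    and zero: "Fs \<subseteq> vanishing 1"
    and G: "G \<in> coord_ring n" and g: "g \<noteq> 0" "\<And>a. poly (expansion G a) 0 = g"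
  obtains a i where "\<And>f. f \<in> Fs \<Longrightarrow> point_eval f a = 0" "point_eval G a \<noteq> 0" "i < n" "a i \<noteq> 0"
proof -
  note S = subring_coord_ring[of n, where 'a = 'k]
  obtain i where i: "i < n" "\<And>k. (radial_coord i * G) ^ k \<notin> generated_ideal n Fs"
    using coord_not_nilpotent[OF infinite_UNIV_alg_closed fin Fs card zero G g] by blast
  have h: "radial_coord i * G \<in> coord_ring n"
    using G i(1) by (intro subring_mult[OF S] radial_coord_in_coord_ring)
  obtain P where P: "generated_ideal n Fs \<subseteq> P" "is_prime_ideal (coord_ring n) P" "radial_coord i * G \<notin> P"
    using prime_ideal_avoiding_powers[OF S is_ideal_generated_ideal[OF Fs] h i(2)] by blast
  obtain a where a: "\<forall>f\<in>P. point_eval f a = 0" "point_eval (radial_coord i * G) a \<noteq> 0"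
    using prime_ideal_zero[OF P(2) h P(3)] by blast
  show ?thesis
    using a i(1) P(1) generator_in_generated_ideal[OF fin] by (intro that[of a i]) auto
qed

section \<open>Distinct points with vanishing power sums\<close>

text \<open>Equations can thus be written as plain functions of the point: the expansion of the
  representing \<open>F\<close> at \<open>a\<close> is \<open>f\<close> along the multiples of
  \<open>a\<close>.\<close>

definition polynomial_fun :: "nat \<Rightarrow> ((nat \<Rightarrow> 'k::field) \<Rightarrow> 'k) \<Rightarrow> bool" where
  "polynomial_fun n f \<longleftrightarrow> (\<exists>F\<in>coord_ring n. \<forall>a t. poly (expansion F a) t = f (\<lambda>i. t * a i))"

lemma polynomial_fun_const: "polynomial_fun n (\<lambda>a. c)"
  unfolding polynomial_fun_def
  by (rule bexI[of _ "radial_const c"]) (simp_all add: radial_const_in_coord_ring)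

lemma polynomial_fun_coord: "i < n \<Longrightarrow> polynomial_fun n (\<lambda>a. a i)"
  unfolding polynomial_fun_def
  by (rule bexI[of _ "radial_coord i"]) (simp_all add: radial_coord_in_coord_ring)

lemma polynomial_fun_add:
  assumes "polynomial_fun n f" "polynomial_fun n g"
  shows "polynomial_fun n (\<lambda>a. f a + g a)"
proof -
  obtain F G where "F \<in> coord_ring n" "G \<in> coord_ring n"
    "\<And>a t. poly (expansion F a) t = f (\<lambda>i. t * a i)" "\<And>a t. poly (expansion G a) t = g (\<lambda>i. t * a i)"
    using assms by (auto simp: polynomial_fun_def)
  then show ?thesis
    unfolding polynomial_fun_def
    by (intro bexI[of _ "F + G"]) (simp_all add: subring_add subring_coord_ring)
qed

lemma polynomial_fun_mult:
  assumes "polynomial_fun n f" "polynomial_fun n g"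
  shows "polynomial_fun n (\<lambda>a. f a * g a)"
proof -
  obtain F G where "F \<in> coord_ring n" "G \<in> coord_ring n"
    "\<And>a t. poly (expansion F a) t = f (\<lambda>i. t * a i)" "\<And>a t. poly (expansion G a) t = g (\<lambda>i. t * a i)"
    using assms by (auto simp: polynomial_fun_def)
  then show ?thesis
    unfolding polynomial_fun_def
    by (intro bexI[of _ "F * G"]) (simp_all add: subring_mult subring_coord_ring)
qed

lemma polynomial_fun_diff:
  assumes "polynomial_fun n f" "polynomial_fun n g"
  shows "polynomial_fun n (\<lambda>a. f a - g a)"
  using polynomial_fun_add[OF assms(1) polynomial_fun_mult[OF polynomial_fun_const[of n "- 1"] assms(2)]]
  by simp

lemma polynomial_fun_power: "polynomial_fun n f \<Longrightarrow> polynomial_fun n (\<lambda>a. f a ^ k)"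
  by (induction k) (auto intro: polynomial_fun_const polynomial_fun_mult)

lemma polynomial_fun_sum:
  "(\<And>i. i \<in> A \<Longrightarrow> polynomial_fun n (f i)) \<Longrightarrow> polynomial_fun n (\<lambda>a. \<Sum>i\<in>A. f i a)"
  by (induction A rule: infinite_finite_induct) (auto intro: polynomial_fun_const polynomial_fun_add)

lemma polynomial_fun_prod:
  "(\<And>i. i \<in> A \<Longrightarrow> polynomial_fun n (f i)) \<Longrightarrow> polynomial_fun n (\<lambda>a. \<Prod>i\<in>A. f i a)"
  by (induction A rule: infinite_finite_induct) (auto intro: polynomial_fun_const polynomial_fun_mult)

text \<open>Setting t = 0 in the expansions shows that the lifted equations have no constant term;
  setting t = 1 turns a common zero of the lifts into one of the given functions. The origin is a
  solution, and a different one is obtained.\<close>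

lemma polynomial_system_nonzero_solution:
  fixes Fs :: "((nat \<Rightarrow> 'k::alg_closed_field) \<Rightarrow> 'k) set"
  assumes fin: "finite Fs" and card: "card Fs < n"
    and Fs: "\<forall>f\<in>Fs. polynomial_fun n f" "\<forall>f\<in>Fs. f (\<lambda>_. 0) = 0"
    and G: "polynomial_fun n G" "G (\<lambda>_. 0) \<noteq> 0"
  obtains a i where "\<forall>f\<in>Fs. f a = 0" "G a \<noteq> 0" "i < n" "a i \<noteq> 0"
proof -
  obtain lift where lift: "\<And>f. f \<in> Fs \<Longrightarrow> lift f \<in> coord_ring n"
    "\<And>f a t. f \<in> Fs \<Longrightarrow> poly (expansion (lift f) a) t = f (\<lambda>i. t * a i)"
    using Fs(1) unfolding polynomial_fun_def by metis
  obtain G' where G': "G' \<in> coord_ring n" "\<And>a t. poly (expansion G' a) t = G (\<lambda>i. t * a i)"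
    using G(1) by (auto simp: polynomial_fun_def)
  have "card (lift ` Fs) < n"
    using card card_image_le[OF fin, of lift] by simp
  moreover have "lift ` Fs \<subseteq> vanishing 1"
  proof safe
    fix f
    assume f: "f \<in> Fs"
    have "poly (expansion (lift f) a) 0 = 0" for a
      using lift(2)[OF f, of a 0] Fs(2) f by simp
    then show "lift f \<in> vanishing 1"
      by (simp add: vanishing_def monom_1_dvd_iff' poly_0_coeff_0)
  qed
  moreover have "lift ` Fs \<subseteq> coord_ring n"
    using lift(1) by blast
  moreover have "poly (expansion G' a) 0 = G (\<lambda>_. 0)" for a
    using G'(2)[of a 0] by simp
  ultimately obtain a i where "\<And>f. f \<in> lift ` Fs \<Longrightarrow> point_eval f a = 0" "point_eval G' a \<noteq> 0"
    "i < n" "a i \<noteq> 0"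
    using exists_nonzero_common_zero[OF finite_imageI[OF fin] _ _ _ G'(1) G(2)] by metis
  then show ?thesis
    using lift(2)[where t = 1 and a = a] G'(2)[where t = 1 and a = a]
    by (intro that[of a i]) (auto simp: point_eval_def)
qed

lemma sum_eq_0_if_power_sums_0:
  fixes e x :: "'i \<Rightarrow> 'k::comm_ring_1"
  assumes "\<And>k. k < m \<Longrightarrow> (\<Sum>i\<in>I. e i * x i ^ k) = 0" "degree q < m"
  shows "(\<Sum>i\<in>I. e i * poly q (x i)) = 0"
proof -
  have "(\<Sum>i\<in>I. e i * poly q (x i)) = (\<Sum>i\<in>I. \<Sum>k\<le>degree q. coeff q k * (e i * x i ^ k))"
    by (simp add: poly_altdef sum_distrib_left mult_ac)
  also have "\<dots> = (\<Sum>k\<le>degree q. coeff q k * (\<Sum>i\<in>I. e i * x i ^ k))"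
    by (subst sum.swap) (simp add: sum_distrib_left)
  also have "\<dots> = 0"
    using assms by simp
  finally show ?thesis .
qed

text \<open>This is the invertibility of the Vandermonde matrix of the distinct values of \<open>x\<close>.\<close>

lemma fibre_sums_eq_0:
  fixes e x :: "'i \<Rightarrow> 'k::field"
  assumes fin: "finite I" and sums: "\<And>k. k < m \<Longrightarrow> (\<Sum>i\<in>I. e i * x i ^ k) = 0"
    and card: "card (x ` I) \<le> m" and c: "c \<in> x ` I"
  shows "(\<Sum>i\<in>{i \<in> I. x i = c}. e i) = 0"
proof -
  define q where "q = (\<Prod>d\<in>x ` I - {c}. [:- d, 1:])"
  have "degree q = card (x ` I - {c})"
    unfolding q_def by (subst degree_prod_eq_sum_degree) auto
  also have "\<dots> < card (x ` I)"
    using fin c by (intro psubset_card_mono) auto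
  finally have "(\<Sum>i\<in>I. e i * poly q (x i)) = 0"
    using card by (intro sum_eq_0_if_power_sums_0[OF sums]) auto
  also have "(\<Sum>i\<in>I. e i * poly q (x i)) = (\<Sum>i\<in>{i \<in> I. x i = c}. e i * poly q c)"
  proof (rule sum.mono_neutral_cong_right)
    show "\<forall>i\<in>I - {i \<in> I. x i = c}. e i * poly q (x i) = 0"
      using fin by (auto simp: q_def poly_prod)
  qed (use fin in auto)
  also have "\<dots> = (\<Sum>i\<in>{i \<in> I. x i = c}. e i) * poly q c"
    by (simp add: sum_distrib_right)
  finally show ?thesis
    using fin by (auto simp: q_def poly_prod)
qed

text \<open>This counts the power-sum equations that remain once Frobenius has disposed of the
  exponents divisible by \<open>p\<close>.\<close>

lemma card_not_dvd:
  assumes "0 < p"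
  shows "card {k \<in> {1..<m}. \<not> p dvd k} + (m - 1) div p = m - 1"
proof -
  have "{k \<in> {1..<m}. p dvd k} = (\<lambda>l. l * p) ` {1..(m - 1) div p}"
  proof (intro equalityI subsetI)
    fix k
    assume "k \<in> {k \<in> {1..<m}. p dvd k}"
    then obtain l where l: "k = l * p" "1 \<le> k" "k \<le> m - 1"
      by (auto simp: dvd_def mult.commute)
    then have "l \<le> (m - 1) div p"
      using assms by (simp add: less_eq_div_iff_mult_less_eq)
    then show "k \<in> (\<lambda>l. l * p) ` {1..(m - 1) div p}"
      using l(1,2) by (intro image_eqI[of _ _ l]) (cases l, auto)
  next
    fix k
    assume "k \<in> (\<lambda>l. l * p) ` {1..(m - 1) div p}"
    then obtain l where "k = l * p" "l \<in> {1..(m - 1) div p}"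
      by blast
    then have l: "k = l * p" "1 \<le> l" "l \<le> (m - 1) div p"
      by simp_all
    then have "l * p \<le> m - 1"
      using assms by (simp add: less_eq_div_iff_mult_less_eq)
    moreover have "1 \<le> l * p"
      using l assms by simp
    ultimately have "1 \<le> k" "k < m"
      unfolding l(1) by linarith+
    then show "k \<in> {k \<in> {1..<m}. p dvd k}"
      using l(1) by simp
  qed
  moreover have "inj_on (\<lambda>l. l * p) {1..(m - 1) div p}"
    using assms by (auto intro: inj_onI)
  ultimately have "card {k \<in> {1..<m}. p dvd k} = (m - 1) div p"
    by (simp add: card_image)
  moreover have "card ({k \<in> {1..<m}. p dvd k} \<union> {k \<in> {1..<m}. \<not> p dvd k}) =
      card {k \<in> {1..<m}. p dvd k} + card {k \<in> {1..<m}. \<not> p dvd k}"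
    by (rule card_Un_disjoint) auto
  moreover have "{k \<in> {1..<m}. p dvd k} \<union> {k \<in> {1..<m}. \<not> p dvd k} = {1..<m}"
    by auto
  ultimately show ?thesis
    by simp
qed

text \<open>
  The points of a block of \<open>P\<close> are moved away from a common value while one point of each block is
  kept fixed. By maximality of \<open>P\<close> a solution that separates some block separates all points,
  the fibres of \<open>x\<close> being adapted unless \<open>x\<close> is injective.
\<close>

lemma exists_distinct_power_sums_0:
  fixes e :: "'i \<Rightarrow> 'k::alg_closed_field" and m p :: nat
  assumes p: "prime p" "CHAR('k) = p" and m: "0 < m" "\<not> p dvd m"
    and I: "finite I" "card I = m + 1" and e: "\<And>i. i \<in> I \<Longrightarrow> e i ^ p = e i"
    and P: "partition_on I P" "\<And>J. J \<in> P \<Longrightarrow> sum e J = 0" "card P \<le> m div p + 1"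
    and max: "\<And>Q. partition_on I Q \<Longrightarrow> (\<And>J. J \<in> Q \<Longrightarrow> sum e J = 0) \<Longrightarrow> refines I Q P \<Longrightarrow> Q = P"
  shows "\<exists>x. inj_on x I \<and> (\<forall>k<m. (\<Sum>i\<in>I. e i * x i ^ k) = 0)"
proof -
  have finP: "finite P"
    using P(1) I(1) by (auto simp: partition_on_def intro: finite_UnionD)
  \<comment> \<open>\<open>k\<close> is infinite, so distinct values can be given to the
    blocks.\<close>
  obtain Y :: "'k set" where "finite Y" "card Y = card P"
    using infinite_arbitrarily_large[OF infinite_UNIV_alg_closed] by blast
  then obtain y :: "'i set \<Rightarrow> 'k" where y: "inj_on y P"
    using finite_same_card_bij[OF finP] by (metis bij_betw_imp_inj_on)
  have "\<exists>J. J \<in> P \<and> i \<in> J" if "i \<in> I" for i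
    using P(1) that by (auto simp: partition_on_def)
  then obtain blk where blk: "\<And>i. i \<in> I \<Longrightarrow> blk i \<in> P" "\<And>i. i \<in> I \<Longrightarrow> i \<in> blk i"
    by metis
  have blk_eq: "blk i = J" if "i \<in> J" "J \<in> P" for i J
    using that P(1) blk[of i] unfolding partition_on_def disjoint_def by blast
  have JI: "J \<subseteq> I" if "J \<in> P" for J
    using that P(1) by (auto simp: partition_on_def)
  have "\<exists>i. i \<in> J" if "J \<in> P" for J
    using that partition_onD3[OF P(1)] by (metis ex_in_conv)
  then obtain rep where rep: "\<And>J. J \<in> P \<Longrightarrow> rep J \<in> J"
    by metis
  \<comment> \<open>One representative of each block stays at the value of the block; the remaining
    points carry the \<open>card I - card P\<close> unknowns.\<close>
  define free where "free = I - rep ` P"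
  have "inj_on rep P"
    by (rule inj_onI) (metis rep blk_eq)
  then have "card free = card I - card P"
    unfolding free_def using rep JI finP by (subst card_Diff_subset) (auto simp: card_image)
  moreover have "finite free"
    using I by (simp add: free_def)
  ultimately obtain \<sigma> where \<sigma>: "bij_betw \<sigma> free {0..<card I - card P}"
    using ex_bij_betw_finite_nat[of free] by auto
  define n where "n = card I - card P"
  define X where "X = (\<lambda>a i. y (blk i) + (if i \<in> free then a (\<sigma> i) else 0))"
  define f where "f = (\<lambda>k a. \<Sum>i\<in>I. e i * X a i ^ k)"
  define K where "K = {k \<in> {1..<m}. \<not> p dvd k}"
  \<comment> \<open>Nonvanishing of \<open>G\<close> keeps points of different blocks apart.\<close>
  define G where "G = (\<lambda>a. \<Prod>i\<in>I. \<Prod>j\<in>{j \<in> I. blk i \<noteq> blk j}. X a i - X a j)"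
  have poly_X: "polynomial_fun n (\<lambda>a. X a i)" for i
  proof (cases "i \<in> free")
    case True
    then have "\<sigma> i < n"
      using bij_betwE[OF \<sigma>] by (auto simp: n_def)
    then show ?thesis
      using True by (auto simp: X_def intro: polynomial_fun_add polynomial_fun_const polynomial_fun_coord)
  qed (simp add: X_def polynomial_fun_const)
  have poly_f: "polynomial_fun n (f k)" for k
    unfolding f_def
    by (intro polynomial_fun_sum polynomial_fun_mult polynomial_fun_power polynomial_fun_const poly_X)
  have poly_G: "polynomial_fun n G"
    unfolding G_def by (intro polynomial_fun_prod polynomial_fun_diff poly_X)
  have group: "(\<Sum>i\<in>I. e i * g (blk i)) = 0" for g
  proof -
    have "(\<Sum>i\<in>I. e i * g (blk i)) = (\<Sum>J\<in>P. \<Sum>i\<in>{i \<in> I. blk i = J}. e i * g (blk i))"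
      using I(1) finP blk(1) by (intro sum.group[symmetric]) auto
    also have "\<dots> = (\<Sum>J\<in>P. sum e J * g J)"
    proof (rule sum.cong[OF refl])
      fix J
      assume J: "J \<in> P"
      then have "{i \<in> I. blk i = J} = J"
        using blk blk_eq JI by blast
      then show "(\<Sum>i\<in>{i \<in> I. blk i = J}. e i * g (blk i)) = sum e J * g J"
        using J blk_eq by (simp add: sum_distrib_right)
    qed
    finally show ?thesis
      using P(2) by simp
  qed
  have f0: "f k (\<lambda>_. 0) = 0" for k
    using group[of "\<lambda>J. y J ^ k"] by (simp add: f_def X_def)
  have G0: "G (\<lambda>_. 0) \<noteq> 0"
    using I(1) y blk(1) by (auto simp: G_def X_def inj_on_def)
  \<comment> \<open>As \<open>p\<close> does not divide \<open>m\<close>, stopping at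
    \<open>m - 1\<close> loses no multiple of \<open>p\<close>; the bound on \<open>card P\<close>
    then leaves fewer equations than unknowns.\<close>
  have "(m - 1) div p = m div p"
    using m div_Suc[of "m - 1" p] by (simp add: dvd_eq_mod_eq_0)
  then have "card K + m div p = m - 1"
    using card_not_dvd[of p m] p(1) by (simp add: K_def prime_gt_0_nat)
  then have "card K < n"
    using P(3) I(2) m(1) by (simp add: n_def)
  then have card: "card (f ` K) < n" and fin: "finite (f ` K)"
    using card_image_le[of K f] by (simp_all add: K_def)
  have "\<forall>g\<in>f ` K. polynomial_fun n g" "\<forall>g\<in>f ` K. g (\<lambda>_. 0) = 0"
    using poly_f f0 by auto
  from polynomial_system_nonzero_solution[OF fin card this poly_G G0]
  obtain a l where a: "\<forall>g\<in>f ` K. g a = 0" "G a \<noteq> 0" and l: "l < n" "a l \<noteq> 0"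
    by blast
  have fa: "f k a = 0" if "k < m" for k
    using that
  proof (induction k rule: less_induct)
    case (less k)
    consider "k = 0" | "k \<in> K" | "k \<noteq> 0" "p dvd k"
      using less.prems by (cases "k = 0"; cases "p dvd k") (auto simp: K_def)
    then show ?case
    proof cases
      case 1
      then show ?thesis
        using group[of "\<lambda>_. 1"] by (simp add: f_def)
    next
      case 2
      then show ?thesis
        using a(1) by blast
    next
      case 3
      \<comment> \<open>Frobenius fixes the weights \<open>e i\<close>, so the power sum of exponent
        \<open>j * p\<close> is the \<open>p\<close>-th power of that of exponent
        \<open>j\<close>.\<close>
      then obtain j where k: "k = j * p"
        by (metis dvdE mult.commute)
      have "0 < j"
        using 3(1) k by (cases j) auto
      then have "j * 1 < j * p"
        using prime_gt_1_nat[OF p(1)] by (intro mult_strict_left_mono)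
      then have "j < k"
        by (simp add: k)
      then have "f j a = 0"
        using less.IH[of j] less.prems by simp
      then have "f j a ^ p = 0"
        using p(1) by (simp add: prime_gt_0_nat)
      moreover have "f j a ^ p = (\<Sum>i\<in>I. (e i * X a i ^ j) ^ p)"
        unfolding f_def using p by (intro freshmans_dream_sum) auto
      moreover have "(\<Sum>i\<in>I. (e i * X a i ^ j) ^ p) = f k a"
        unfolding f_def by (intro sum.cong) (simp_all add: power_mult_distrib e k flip: power_mult)
      ultimately show ?thesis
        by simp
    qed
  qed
  have "inj_on (X a) I"
  proof (rule ccontr)
    assume "\<not> inj_on (X a) I"
    then have "card (X a ` I) \<noteq> card I"
      using eq_card_imp_inj_on[OF I(1)] by blast
    then have card_le: "card (X a ` I) \<le> m"
      using card_image_le[OF I(1), of "X a"] I(2) by linarith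
    define Q where "Q = (\<lambda>c. {i \<in> I. X a i = c}) ` X a ` I"
    have Q: "partition_on I Q"
      by (rule partition_onI) (auto simp: Q_def disjnt_def)
    moreover have "sum e J = 0" if J: "J \<in> Q" for J
    proof -
      obtain c where c: "c \<in> X a ` I" "J = {i \<in> I. X a i = c}"
        using J unfolding Q_def by blast
      show ?thesis
        unfolding c(2) by (rule fibre_sums_eq_0[OF I(1) fa[unfolded f_def] card_le c(1)])
    qed
    moreover have "refines I Q P"
      unfolding refines_def
    proof (intro conjI ballI Q P(1))
      fix J
      assume "J \<in> Q"
      then obtain i where i: "i \<in> I" "J = {j \<in> I. X a j = X a i}"
        by (auto simp: Q_def)
      have "blk j = blk i" if "j \<in> I" "X a j = X a i" for j
      proof (rule ccontr)
        assume "blk j \<noteq> blk i"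
        then show False
          using a(2) I(1) that i(1) by (auto simp: G_def)
      qed
      then have "J \<subseteq> blk i"
        using i(2) blk(2) by auto
      then show "\<exists>J'\<in>P. J \<subseteq> J'"
        using blk(1)[OF i(1)] by blast
    qed
    ultimately have QP: "Q = P"
      by (rule max)
    \<comment> \<open>The nonzero coordinate \<open>a l\<close> moves a free point away from the
      representative of its block, so that block is not a fibre.\<close>
    have "l \<in> \<sigma> ` free"
      using l(1) bij_betw_imp_surj_on[OF \<sigma>] by (simp add: n_def)
    then obtain i where i: "i \<in> free" "\<sigma> i = l"
      by blast
    then have iI: "i \<in> I"
      by (simp add: free_def)
    let ?r = "rep (blk i)"
    have r: "?r \<in> blk i" "?r \<notin> free" "blk ?r = blk i"
      using blk(1)[OF iI] rep[OF blk(1)[OF iI]] blk_eq by (auto simp: free_def)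
    then have "X a i \<noteq> X a ?r"
      using i l(2) by (simp add: X_def)
    moreover obtain c where "blk i = {j \<in> I. X a j = c}"
      using blk(1)[OF iI] QP by (auto simp: Q_def)
    ultimately show False
      using r(1) blk(2)[OF iI] by auto
  qed
  then show ?thesis
    using fa by (intro exI[of _ "X a"]) (simp add: f_def)
qed

section \<open>Differential forms on the projective line\<close>

lemma sum_pCons: "(\<Sum>i\<in>A. pCons (g i) (h i)) = pCons (\<Sum>i\<in>A. g i) (\<Sum>i\<in>A. h i)"
  by (induction A rule: infinite_finite_induct) simp_all

text \<open>
  The quotient of \<open>\<Prod>j. (t - x\<^sub>j)\<close> by \<open>t - x\<^sub>i\<close> is a synthetic division, whose coefficients are
  polynomials in \<open>x\<^sub>i\<close>: all power sums but the last one drop out.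
\<close>

lemma partial_fraction_numerator_const:
  fixes e x :: "'i \<Rightarrow> 'k::field"
  assumes I: "finite I" "card I = m + 1" and inj: "inj_on x I"
    and sums: "\<And>k. k < m \<Longrightarrow> (\<Sum>i\<in>I. e i * x i ^ k) = 0"
    and i\<^sub>0: "i\<^sub>0 \<in> I" "e i\<^sub>0 \<noteq> 0"
  shows "\<exists>c. c \<noteq> 0 \<and> (\<Sum>i\<in>I. smult (e i) (\<Prod>j\<in>I - {i}. [:- x j, 1:])) = [:c:]"
proof -
  define D where "D = (\<Prod>j\<in>I. [:- x j, 1:])"
  \<comment> \<open>Dividing \<open>pCons a q\<close> by t - x gives constant term
    \<open>poly q x\<close> and then the quotient of \<open>q\<close>; so only power sums of
    exponent below \<open>m\<close> occur.\<close>
  have vanish: "(\<Sum>i\<in>I. smult (e i) (synthetic_div q (x i))) = 0" if "degree q \<le> m" for q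
    using that
  proof (induction q)
    case (pCons a q)
    show ?case
    proof (cases "q = 0")
      case False
      then have "degree q < m"
        using pCons.prems by simp
      then show ?thesis
        using pCons.IH sum_eq_0_if_power_sums_0[of m e x I q] sums by (simp add: sum_pCons)
    qed simp
  qed simp
  have "degree D = m + 1"
    unfolding D_def using I by (subst degree_prod_eq_sum_degree) auto
  moreover obtain a q where Dq: "D = pCons a q"
    by (cases D)
  ultimately have "degree q \<le> m"
    by (simp split: if_splits)
  then have *: "(\<Sum>i\<in>I. smult (e i) (synthetic_div D (x i))) = [:\<Sum>i\<in>I. e i * poly q (x i):]"
    by (simp add: Dq sum_pCons vanish)
  have "synthetic_div D (x i) = (\<Prod>j\<in>I - {i}. [:- x j, 1:])" if "i \<in> I" for i
  proof -
    have D: "D = [:- x i, 1:] * (\<Prod>j\<in>I - {i}. [:- x j, 1:])"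
      unfolding D_def using I(1) that by (rule prod.remove)
    then have "poly D (x i) = 0"
      by simp
    then have "[:- x i, 1:] * synthetic_div D (x i) = D"
      using synthetic_div_correct'[of "x i" D] by simp
    then show ?thesis
      using D by (metis mult_cancel_left pCons_eq_0_iff zero_neq_one)
  qed
  with * have eq: "(\<Sum>i\<in>I. smult (e i) (\<Prod>j\<in>I - {i}. [:- x j, 1:])) = [:\<Sum>i\<in>I. e i * poly q (x i):]"
    by simp
  \<comment> \<open>At \<open>x i\<^sub>0\<close> only the summand of \<open>i\<^sub>0\<close>
    survives; it is nonzero because the points are distinct and its weight is nonzero.\<close>
  have "poly (\<Sum>i\<in>I. smult (e i) (\<Prod>j\<in>I - {i}. [:- x j, 1:])) (x i\<^sub>0) =
      (\<Sum>i\<in>I. e i * (\<Prod>j\<in>I - {i}. x i\<^sub>0 - x j))"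
    by (simp add: poly_sum poly_prod)
  also have "\<dots> = (\<Sum>i\<in>{i\<^sub>0}. e i * (\<Prod>j\<in>I - {i}. x i\<^sub>0 - x j))"
    using I(1) i\<^sub>0(1) by (intro sum.mono_neutral_right) auto
  also have "\<dots> \<noteq> 0"
    using I(1) i\<^sub>0 inj by (auto simp: inj_on_def)
  finally show ?thesis
    using eq by auto
qed

text \<open>The logarithmic derivative of the product is the sum of the \<open>n i / f i\<close>;
  here it is cleared of denominators.\<close>

lemma pderiv_prod_power:
  fixes f :: "'i \<Rightarrow> 'k::field poly"
  assumes "finite I" "\<And>i. i \<in> I \<Longrightarrow> pderiv (f i) = 1"
  shows "pderiv (\<Prod>i\<in>I. f i ^ n i) * (\<Prod>i\<in>I. f i) =
    (\<Sum>i\<in>I. smult (of_nat (n i)) (\<Prod>j\<in>I - {i}. f j)) * (\<Prod>i\<in>I. f i ^ n i)"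
  using assms
proof (induction I rule: finite_induct)
  case (insert a I)
  let ?U = "\<Prod>i\<in>I. f i ^ n i" and ?D = "\<Prod>i\<in>I. f i"
  let ?N = "\<Sum>i\<in>I. smult (of_nat (n i)) (\<Prod>j\<in>I - {i}. f j)"
  have "insert a I - {i} = insert a (I - {i})" if "i \<in> I" for i
    using that insert.hyps by auto
  then have "(\<Sum>i\<in>I. smult (of_nat (n i)) (\<Prod>j\<in>insert a I - {i}. f j)) =
      (\<Sum>i\<in>I. f a * smult (of_nat (n i)) (\<Prod>j\<in>I - {i}. f j))"
    using insert.hyps by (intro sum.cong) auto
  moreover have "insert a I - {a} = I"
    using insert.hyps by auto
  ultimately have N: "(\<Sum>i\<in>insert a I. smult (of_nat (n i)) (\<Prod>j\<in>insert a I - {i}. f j)) =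
      smult (of_nat (n a)) ?D + f a * ?N"
    using insert.hyps by (simp add: sum_distrib_left)
  have IH: "pderiv ?U * ?D = ?N * ?U"
    using insert by simp
  have fa: "f a * pderiv (f a ^ n a) = smult (of_nat (n a)) (f a ^ n a)"
  proof (cases "n a")
    case (Suc k)
    have "pderiv (f a ^ Suc k) = smult (of_nat (Suc k)) (f a ^ k)"
      using pderiv_power_Suc[of "f a" k] insert.prems[of a] by simp
    then show ?thesis
      by (simp only: Suc mult_smult_right power_Suc)
  qed simp
  have "pderiv (f a ^ n a * ?U) * (f a * ?D) =
      (f a * pderiv (f a ^ n a)) * ?U * ?D + f a ^ n a * f a * (pderiv ?U * ?D)"
    by (simp add: pderiv_mult algebra_simps)
  also have "\<dots> = (smult (of_nat (n a)) ?D + f a * ?N) * (f a ^ n a * ?U)"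
    by (simp only: fa IH) (simp add: algebra_simps)
  finally show ?case
    using insert.hyps N by simp
qed simp

section \<open>Expansions, orders and residues at points of the projective line\<close>

lemma poly_at_1 [simp]: "poly_at z 1 = 1"
  by (simp add: one_pCons poly_at_pCons)

lemma poly_at_const [simp]: "poly_at z [:c:] = fls_const c"
  by (simp add: poly_at_pCons)

lemma fls_nth_poly_at_finite:
  "n < 0 \<Longrightarrow> fls_nth (poly_at (Finite_Point y) q) n = 0"
  "fls_nth (poly_at (Finite_Point y) q) 0 = poly q y"
proof -
  have "(\<forall>n<0. fls_nth (poly_at (Finite_Point y) q) n = 0) \<and> fls_nth (poly_at (Finite_Point y) q) 0 = poly q y"
    by (induction q) (auto simp: poly_at_pCons distrib_right fls_X_times_conv_shift)
  then show "n < 0 \<Longrightarrow> fls_nth (poly_at (Finite_Point y) q) n = 0"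
    "fls_nth (poly_at (Finite_Point y) q) 0 = poly q y"
    by auto
qed

lemma subdegree_poly_at_finite_nonroot:
  "poly q y \<noteq> 0 \<Longrightarrow> fls_subdegree (poly_at (Finite_Point y) q) = 0"
  by (rule fls_subdegree_eqI) (simp_all add: fls_nth_poly_at_finite)

lemma poly_at_root: "poly_at (Finite_Point x) [:- x, 1:] = fls_X"
proof -
  have "fls_const (- x) + fls_const x = (0 :: 'a fls)"
    by (simp add: fls_plus_const)
  then show ?thesis
    by (simp add: poly_at_pCons)
qed

lemma subdegree_poly_at_linear:
  "fls_subdegree (poly_at (Finite_Point y) [:- x, 1:]) = (if y = x then 1 else 0)"
  "fls_subdegree (poly_at Infinity_Point [:- x, 1:]) = -1"
proof -
  show "fls_subdegree (poly_at (Finite_Point y) [:- x, 1:]) = (if y = x then 1 else 0)"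
    using subdegree_poly_at_finite_nonroot[of "[:- x, 1:]" y] poly_at_root[of x] by auto
  show "fls_subdegree (poly_at Infinity_Point [:- x, 1:]) = -1"
    by (rule fls_subdegree_eqI) (simp_all add: poly_at_pCons)
qed

lemma subdegree_poly_at_prod:
  fixes f :: "'i \<Rightarrow> 'k::field poly"
  assumes "finite I" "\<And>i. i \<in> I \<Longrightarrow> f i \<noteq> 0"
  shows "fls_subdegree (poly_at z (\<Prod>i\<in>I. f i ^ l i)) = (\<Sum>i\<in>I. int (l i) * fls_subdegree (poly_at z (f i)))"
proof -
  have pow: "fls_subdegree (poly_at z (q ^ n)) = int n * fls_subdegree (poly_at z q)" if "q \<noteq> 0"
    for q :: "'k poly" and n
    using that by (induction n) (simp_all add: poly_at_mult algebra_simps)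
  show ?thesis
    using assms
  proof (induction I rule: finite_induct)
    case (insert a I)
    then have "(\<Prod>i\<in>I. f i ^ l i) \<noteq> 0"
      by (simp add: prod_zero_iff)
    then show ?case
      using insert by (simp add: poly_at_mult pow)
  qed simp
qed

lemma form_at_Fract_const:
  assumes "D \<noteq> 0"
  shows "form_at z (Fract [:c:] D) = fls_const c / poly_at z D * fls_deriv (coord_at z)"
  using assms by (simp add: form_at_def fract_at_Fract)

lemma fls_deriv_coord_at:
  "fls_deriv (coord_at (Finite_Point y)) = 1"
  "fls_subdegree (fls_deriv (coord_at Infinity_Point :: 'k::field fls)) = -2"
  "fls_deriv (coord_at Infinity_Point :: 'k::field fls) \<noteq> 0"
proof -
  show "fls_deriv (coord_at (Finite_Point y)) = 1"
    by simp
  have nth: "fls_nth (fls_deriv (fls_X_inv :: 'k fls)) n = (if n = -2 then -1 else 0)" for n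
    by (auto simp: fls_deriv_nth)
  show "fls_subdegree (fls_deriv (coord_at Infinity_Point :: 'k fls)) = -2"
    by (rule fls_subdegree_eqI) (simp_all add: nth)
  show "fls_deriv (coord_at Infinity_Point :: 'k fls) \<noteq> 0"
    using nth[of "-2"] by (metis coord_at.simps(2) fls_zero_nth neg_equal_0_iff_equal zero_neq_one)
qed

text \<open>The form has no finite zeros. At infinity dt has a double pole, so the order is the
  degree of the denominator minus 2, which \<open>sum\<close> makes equal to
  \<open>- (ht_m H a\<^sub>0 + 1)\<close>.\<close>

lemma form_has_vertex_divisor:
  fixes x :: "'e \<Rightarrow> 'k::field" and H :: "('v, 'e, 'p::prime_card) hurwitz_datum"
  assumes A: "finite (arcs_from \<Gamma> s)" "a\<^sub>0 \<in> arcs_from \<Gamma> s"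
    and sum: "(\<Sum>a\<in>arcs_from \<Gamma> s. ht_m H a + 1) = 2"
    and nonneg: "\<And>a. a \<in> arcs_from \<Gamma> s - {a\<^sub>0} \<Longrightarrow> 0 \<le> ht_m H a"
    and c: "c \<noteq> 0"
    and j: "j = (\<lambda>a. if a = a\<^sub>0 then Infinity_Point else Finite_Point (x a))"
  shows "form_has_divisor (Fract [:c:] (\<Prod>a\<in>arcs_from \<Gamma> s - {a\<^sub>0}. [:- x a, 1:] ^ nat (ht_m H a + 1)))
    (vertex_divisor \<Gamma> H s j)"
proof -
  let ?A = "arcs_from \<Gamma> s" and ?I = "arcs_from \<Gamma> s - {a\<^sub>0}"
  define D where "D = (\<Prod>a\<in>?I. [:- x a, 1:] ^ nat (ht_m H a + 1))"
  have D0: "D \<noteq> 0"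
    using A(1) by (simp add: D_def prod_zero_iff)
  have split: "(\<Sum>a\<in>?A. f a) = f a\<^sub>0 + (\<Sum>a\<in>?I. f a)" for f :: "'e \<Rightarrow> int"
    using A by (rule sum.remove)
  have ord: "fls_subdegree (poly_at z D) = (\<Sum>a\<in>?I. (ht_m H a + 1) * fls_subdegree (poly_at z [:- x a, 1:]))" for z
    unfolding D_def using A(1) nonneg by (subst subdegree_poly_at_prod) (auto intro!: sum.cong)
  have "fls_subdegree (form_at z (Fract [:c:] D)) = vertex_divisor \<Gamma> H s j z" for z
  proof -
    have deriv: "fls_deriv (coord_at z) \<noteq> 0"
      by (cases z) (use fls_deriv_coord_at(3) in auto)
    have F0: "fls_const c / poly_at z D \<noteq> 0"
      using c D0 by simp
    have "fls_subdegree (fls_const c / poly_at z D) + fls_subdegree (poly_at z D) = fls_subdegree (fls_const c)"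
      using F0 D0 by (subst fls_subdegree_mult[symmetric]) auto
    then have "fls_subdegree (form_at z (Fract [:c:] D)) =
        fls_subdegree (fls_deriv (coord_at z)) - fls_subdegree (poly_at z D)"
      unfolding form_at_Fract_const[OF D0] fls_subdegree_mult[OF F0 deriv] fls_const_subdegree by linarith
    also have "\<dots> = vertex_divisor \<Gamma> H s j z"
    proof (cases z)
      case (Finite_Point y)
      then show ?thesis
        by (simp only: ord) (auto simp: vertex_divisor_def split point_divisor_def j subdegree_poly_at_linear
            intro!: sum.cong)
    next
      case Infinity_Point
      have "(\<Sum>a\<in>?I. ht_m H a + 1) = 2 - (ht_m H a\<^sub>0 + 1)"
        using sum split[of "\<lambda>a. ht_m H a + 1"] by simp
      moreover have "(\<Sum>a\<in>?I. (ht_m H a + 1) * point_divisor (j a) Infinity_Point) = 0"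
        by (rule sum.neutral) (simp add: point_divisor_def j)
      moreover have "(\<Sum>a\<in>?I. (ht_m H a + 1) * - 1) = - (\<Sum>a\<in>?I. ht_m H a + 1)"
        by (simp only: mult_minus_right mult_1_right sum_negf)
      moreover have "(ht_m H a\<^sub>0 + 1) * point_divisor (j a\<^sub>0) Infinity_Point = ht_m H a\<^sub>0 + 1"
        by (simp add: point_divisor_def j)
      ultimately show ?thesis
        unfolding Infinity_Point ord subdegree_poly_at_linear fls_deriv_coord_at(2) vertex_divisor_def split
        by linarith
    qed
    finally show ?thesis .
  qed
  moreover have "Fract [:c:] D \<noteq> 0"
    using c D0 by (simp add: Zero_fract_def eq_fract)
  ultimately show ?thesis
    by (simp add: form_has_divisor_def D_def)
qed

text \<open>The residue is the constant term of the form times the parameter t - x; multiplying by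
  the expansion of \<open>q\<close> and comparing lowest coefficients gives it.\<close>

lemma residue_at_simple_pole:
  fixes q :: "'k::field poly"
  assumes "poly q x \<noteq> 0"
  shows "form_residue (Fract [:c:] ([:- x, 1:] * q)) (Finite_Point x) = c / poly q x"
proof -
  let ?z = "Finite_Point x"
  have q: "q \<noteq> 0"
    using assms by auto
  define F where "F = fls_const c / poly_at ?z ([:- x, 1:] * q)"
  have "F * (fls_X * poly_at ?z q) = fls_const c"
    using q unfolding F_def poly_at_mult poly_at_root by simp
  then have eq: "(fls_X * F) * poly_at ?z q = fls_const c"
    by (simp add: mult_ac)
  have "fls_nth (fls_X * F) 0 * poly q x = c"
  proof (cases "c = 0")
    case False
    then have nz: "fls_X * F \<noteq> 0" "poly_at ?z q \<noteq> 0"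
      using eq by auto
    have "fls_subdegree ((fls_X * F) * poly_at ?z q) = 0"
      by (simp only: eq fls_const_subdegree)
    then have sub: "fls_subdegree (fls_X * F) = 0"
      using fls_subdegree_mult[OF nz] subdegree_poly_at_finite_nonroot[OF assms] by linarith
    have "fls_nth ((fls_X * F) * poly_at ?z q) (fls_subdegree (fls_X * F) + fls_subdegree (poly_at ?z q)) =
        fls_nth (fls_X * F) (fls_subdegree (fls_X * F)) * fls_nth (poly_at ?z q) (fls_subdegree (poly_at ?z q))"
      by (rule fls_times_base)
    then show ?thesis
      unfolding sub subdegree_poly_at_finite_nonroot[OF assms] eq
      by (simp only: fls_nth_poly_at_finite) simp
  next
    case True
    then show ?thesis
      by (simp add: F_def)
  qed
  moreover have "fls_nth (fls_X * F) 0 = fls_nth F (-1)"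
    by (simp add: fls_X_times_conv_shift)
  moreover have "[:- x, 1:] * q \<noteq> 0"
    using q by (simp only: mult_eq_0_iff) simp
  then have "form_at ?z (Fract [:c:] ([:- x, 1:] * q)) = F"
    unfolding F_def by (subst form_at_Fract_const) (simp_all only: fls_deriv_coord_at mult_1_right not_False_eq_True)
  ultimately show ?thesis
    using assms by (simp add: form_residue_def fls_residue_def field_simps)
qed

section \<open>The embedding of the prime field into a field of the same characteristic\<close>

lemma of_int_to_int_of_int:
  assumes "CHAR('k::ring_1) = CARD('p::prime_card)"
  shows "of_int (to_int_mod_ring (of_int z :: 'p mod_ring)) = (of_int z :: 'k)"
proof -
  have "to_int_mod_ring (of_int z :: 'p mod_ring) = z mod int CARD('p)"
    unfolding of_int_of_int_mod_ring by transfer simp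
  then show ?thesis
    by (simp add: of_int_eq_iff_cong_CHAR assms cong_def)
qed

lemma of_int_to_int_add:
  assumes "CHAR('k::ring_1) = CARD('p::prime_card)"
  shows "of_int (to_int_mod_ring (a + b :: 'p mod_ring)) =
    (of_int (to_int_mod_ring a) + of_int (to_int_mod_ring b) :: 'k)"
proof -
  have *: "of_int (to_int_mod_ring c) = c" for c :: "'p mod_ring"
    by (simp add: of_int_of_int_mod_ring)
  have "a + b = of_int (to_int_mod_ring a + to_int_mod_ring b)"
    by (simp add: *)
  then show ?thesis
    using of_int_to_int_of_int[OF assms, of "to_int_mod_ring a + to_int_mod_ring b"] by (simp only: of_int_add)
qed

lemma of_int_to_int_sum:
  assumes "CHAR('k::ring_1) = CARD('p::prime_card)"
  shows "of_int (to_int_mod_ring (\<Sum>i\<in>J. e i :: 'p mod_ring)) = (\<Sum>i\<in>J. of_int (to_int_mod_ring (e i)) :: 'k)"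
  by (induction J rule: infinite_finite_induct) (simp_all add: of_int_to_int_add[OF assms])

lemma of_int_to_int_eq_0_iff:
  assumes "CHAR('k::ring_1) = CARD('p::prime_card)"
  shows "of_int (to_int_mod_ring (a :: 'p mod_ring)) = (0 :: 'k) \<longleftrightarrow> a = 0"
proof
  assume "of_int (to_int_mod_ring a) = (0 :: 'k)"
  then have "int CARD('p) dvd to_int_mod_ring a"
    by (simp add: of_int_eq_0_iff_char_dvd assms)
  moreover have "to_int_mod_ring a \<in> {0..<int CARD('p)}"
    using range_to_int_mod_ring by blast
  ultimately have "to_int_mod_ring a = 0"
    using zdvd_not_zless by force
  then show "a = 0"
    by simp
qed simp

text \<open>Fermat's little theorem, by induction on a natural number with the additivity of
  Frobenius.\<close>

lemma of_int_power_CHAR: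
  assumes "prime CHAR('k::comm_ring_1)" "0 \<le> z"
  shows "of_int z ^ CHAR('k) = (of_int z :: 'k)"
proof -
  have "of_nat n ^ CHAR('k) = (of_nat n :: 'k)" for n
    using assms(1) by (induction n) (simp_all add: freshmans_dream prime_gt_0_nat zero_power)
  from this[of "nat z"] show ?thesis
    using assms(2) by simp
qed

text \<open>The common core of both cases. The prime field embeds in \<open>k\<close>, so
  adaptedness can be tested there; the integer \<open>m\<close> and the floor become a natural
  number and a natural division.\<close>

lemma adapted_partition_distinct_points:
  fixes e :: "'i \<Rightarrow> 'p::prime_card mod_ring"
  assumes char: "CHAR('k::alg_closed_field) = CARD('p)"
    and I: "finite I" "int (card I) = m + 1" and m: "0 < m" "coprime m (int CARD('p))"
    and P: "maximal_adapted_partition I e P" "int (card P) \<le> \<lfloor>real_of_int m / real CARD('p)\<rfloor> + 1"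
    and i\<^sub>0: "i\<^sub>0 \<in> I" "e i\<^sub>0 \<noteq> 0"
  shows "\<exists>(x :: 'i \<Rightarrow> 'k) c. inj_on x I \<and> c \<noteq> 0 \<and>
    (\<Sum>i\<in>I. smult (of_int (to_int_mod_ring (e i))) (\<Prod>j\<in>I - {i}. [:- x j, 1:])) = [:c:]"
proof -
  define n where "n = nat m"
  have mn: "m = int n"
    using m(1) by (simp add: n_def)
  let ?p = "CARD('p)" and ?e = "\<lambda>i. of_int (to_int_mod_ring (e i)) :: 'k"
  have p: "prime ?p"
    by (rule prime_card)
  have sum0: "sum ?e J = 0 \<longleftrightarrow> sum e J = 0" for J
    by (simp flip: of_int_to_int_sum[OF char] add: of_int_to_int_eq_0_iff[OF char])
  have ad: "adapted_partition I e Q \<longleftrightarrow> partition_on I Q \<and> (\<forall>J\<in>Q. sum ?e J = 0)" for Q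
    by (simp only: adapted_partition_def sum0)
  have "\<not> int ?p dvd m"
  proof
    assume "int ?p dvd m"
    then have "is_unit (int ?p)"
      by (rule coprime_common_divisor[OF m(2) _ dvd_refl])
    then show False
      using prime_gt_1_nat[OF p] by simp
  qed
  then have n: "0 < n" "\<not> ?p dvd n"
    using m(1) by (simp_all add: mn)
  have cardI: "card I = n + 1"
    using I(2) by (simp add: mn)
  have "\<lfloor>real_of_int m / real ?p\<rfloor> = int (n div ?p)"
    using floor_divide_of_int_eq[of m "int ?p"] by (simp add: mn zdiv_int)
  then have cardP: "card P \<le> n div ?p + 1"
    using P(2) by simp
  have frob: "?e i ^ ?p = ?e i" for i
  proof -
    have "0 \<le> to_int_mod_ring (e i)"
      using range_to_int_mod_ring[where 'a = 'p] by (metis atLeastLessThan_iff rangeI)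
    then show ?thesis
      using of_int_power_CHAR[where 'k = 'k] p by (simp add: char)
  qed
  have part: "partition_on I P" "\<And>J. J \<in> P \<Longrightarrow> sum ?e J = 0"
    and max: "\<And>Q. partition_on I Q \<Longrightarrow> (\<And>J. J \<in> Q \<Longrightarrow> sum ?e J = 0) \<Longrightarrow> refines I Q P \<Longrightarrow> Q = P"
    using P(1) unfolding maximal_adapted_partition_def ad by blast+
  obtain x :: "'i \<Rightarrow> 'k" where x: "inj_on x I" "\<forall>k<n. (\<Sum>i\<in>I. ?e i * x i ^ k) = 0"
    using exists_distinct_power_sums_0[where e = ?e, OF p char n I(1) cardI frob part cardP max] by blast
  have "?e i\<^sub>0 \<noteq> 0"
    using i\<^sub>0(2) by (simp add: of_int_to_int_eq_0_iff[OF char])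
  then have "\<exists>c. c \<noteq> 0 \<and> (\<Sum>i\<in>I. smult (?e i) (\<Prod>j\<in>I - {i}. [:- x j, 1:])) = [:c:]"
    using x by (intro partial_fraction_numerator_const[OF I(1) cardI _ _ i\<^sub>0(1)]) simp_all
  then show ?thesis
    using x(1) by blast
qed

section \<open>Rational functions that realize a vertex, built from the distinct points\<close>

lemma multiplicative_realizableI:
  fixes x :: "'e \<Rightarrow> 'k::field" and H :: "('v, 'e, 'p::prime_card) hurwitz_datum"
  assumes A: "finite (arcs_from \<Gamma> s)" "a\<^sub>0 \<in> arcs_from \<Gamma> s" and I: "I = arcs_from \<Gamma> s - {a\<^sub>0}"
    and sum: "(\<Sum>a\<in>arcs_from \<Gamma> s. ht_m H a + 1) = 2"
    and m: "ht_m H a\<^sub>0 < 0" "\<And>a. a \<in> I \<Longrightarrow> ht_m H a = 0" and h\<^sub>0: "ht_h H a\<^sub>0 = 0"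
    and x: "inj_on x I" and c: "c \<noteq> 0"
    and eq: "(\<Sum>i\<in>I. smult (of_int (to_int_mod_ring (ht_h H i))) (\<Prod>j\<in>I - {i}. [:- x j, 1:])) = [:c:]"
  shows "multiplicative_realizable TYPE('k) \<Gamma> H s"
proof -
  define j where "j = (\<lambda>a. if a = a\<^sub>0 then Infinity_Point else Finite_Point (x a))"
  \<comment> \<open>Exponents are the representatives of \<open>h\<close> between 0 and p - 1, so
    that \<open>U\<close> is a polynomial.\<close>
  define n where "n a = nat (to_int_mod_ring (ht_h H a))" for a
  define U where "U = (\<Prod>a\<in>I. [:- x a, 1:] ^ n a)"
  define D where "D = (\<Prod>a\<in>I. [:- x a, 1:])"
  have fin: "finite I"
    using A(1) I by simp
  have U0: "U \<noteq> 0" and D0: "D \<noteq> 0"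
    using fin by (simp_all add: U_def D_def prod_zero_iff)
  have n: "of_nat (n a) = (of_int (to_int_mod_ring (ht_h H a)) :: 'k)" for a
  proof -
    have "0 \<le> to_int_mod_ring (ht_h H a)"
      using range_to_int_mod_ring[where 'a = 'p] by (metis atLeastLessThan_iff rangeI)
    then show ?thesis
      by (simp add: n_def)
  qed
  have "pderiv U * D = [:c:] * U"
    unfolding U_def D_def using pderiv_prod_power[OF fin, of "\<lambda>a. [:- x a, 1:]" n] eq
    by (simp add: n pderiv_pCons)
  then have form: "fract_deriv (Fract U 1) / Fract U 1 = Fract [:c:] D"
    using U0 D0 by (simp add: fract_deriv_Fract eq_fract mult.commute)
  have D: "D = (\<Prod>a\<in>arcs_from \<Gamma> s - {a\<^sub>0}. [:- x a, 1:] ^ nat (ht_m H a + 1))"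
    unfolding D_def I using m(2) by (intro prod.cong) (auto simp: I)
  have div: "form_has_divisor (Fract [:c:] D) (vertex_divisor \<Gamma> H s j)"
    unfolding D using m(2) I by (intro form_has_vertex_divisor[OF A sum _ c j_def]) auto
  have "form_residue (Fract [:c:] D) (j a) = of_int (to_int_mod_ring (ht_h H a))" if a: "a \<in> arcs_from \<Gamma> s" for a
  proof (cases "a = a\<^sub>0")
    case True
    \<comment> \<open>The order at infinity is \<open>- (ht_m H a\<^sub>0 + 1)\<close>, which is
      nonnegative; so the residue there is 0, in accordance with \<open>h\<^sub>0\<close>.\<close>
    have "vertex_divisor \<Gamma> H s j Infinity_Point = - (\<Sum>a\<in>{a\<^sub>0}. ht_m H a + 1)"
      unfolding vertex_divisor_def using A
      by (intro arg_cong[of _ _ uminus] sum.mono_neutral_cong_right) (auto simp: point_divisor_def j_def)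
    then have "0 \<le> fls_subdegree (form_at Infinity_Point (Fract [:c:] D))"
      using div m(1) by (simp add: form_has_divisor_def)
    then show ?thesis
      using True h\<^sub>0 by (simp add: form_residue_def j_def fls_residue_def)
  next
    case False
    then have aI: "a \<in> I"
      using a I by simp
    let ?q = "\<Prod>b\<in>I - {a}. [:- x b, 1:]"
    have q: "poly ?q (x a) \<noteq> 0"
      using fin x aI by (auto simp: poly_prod inj_on_def)
    \<comment> \<open>Evaluating the numerator identity at \<open>x a\<close> leaves only the
      summand of \<open>a\<close>, which yields the residue.\<close>
    have "c = poly [:c:] (x a)"
      by simp
    also have "\<dots> = (\<Sum>i\<in>I. of_int (to_int_mod_ring (ht_h H i)) * poly (\<Prod>j\<in>I - {i}. [:- x j, 1:]) (x a))"
      by (simp flip: eq add: poly_sum)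
    also have "\<dots> = (\<Sum>i\<in>{a}. of_int (to_int_mod_ring (ht_h H i)) * poly (\<Prod>j\<in>I - {i}. [:- x j, 1:]) (x a))"
      using fin aI by (intro sum.mono_neutral_right) (auto simp: poly_prod)
    finally have "c / poly ?q (x a) = of_int (to_int_mod_ring (ht_h H a))"
      using q by (simp add: field_simps)
    moreover have "D = [:- x a, 1:] * ?q"
      unfolding D_def using fin aI by (rule prod.remove)
    ultimately show ?thesis
      using residue_at_simple_pole[OF q, of c] False by (simp only: j_def if_False)
  qed
  moreover have "inj_on j (arcs_from \<Gamma> s)"
    using x by (auto simp: j_def I inj_on_def)
  moreover have "Fract U 1 \<noteq> 0"
    using U0 by (simp add: Zero_fract_def eq_fract)
  ultimately show ?thesis
    unfolding multiplicative_realizable_def using div form by metis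
qed

lemma additive_realizableI:
  fixes x :: "'e + 'i \<Rightarrow> 'k::field" and H :: "('v, 'e, 'p::prime_card) hurwitz_datum"
  assumes char: "CHAR('k) = CARD('p)"
    and A: "finite (arcs_from \<Gamma> s)" "a\<^sub>0 \<in> arcs_from \<Gamma> s" and I': "I' = arcs_from \<Gamma> s - {a\<^sub>0}"
    and T: "finite T" and I: "I = I' <+> T"
    and sum: "(\<Sum>a\<in>arcs_from \<Gamma> s. ht_m H a + 1) = 2"
    and m: "\<And>a. a \<in> I' \<Longrightarrow> 0 < ht_m H a"
    and x: "inj_on x I" and c: "c \<noteq> 0"
    and eq: "(\<Sum>i\<in>I. smult (of_int (to_int_mod_ring (additive_family H i))) (\<Prod>j\<in>I - {i}. [:- x j, 1:])) = [:c:]"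
  shows "additive_realizable TYPE('k) \<Gamma> H s"
proof -
  define j where "j = (\<lambda>a. if a = a\<^sub>0 then Infinity_Point else Finite_Point (x (Inl a)))"
  define n where "n a = nat (ht_m H a)" for a
  define f where "f i = [:- x i, 1:]" for i
  define N where "N = (\<Prod>z\<in>T. f (Inr z))"
  define D where "D = (\<Prod>a\<in>I'. f (Inl a) ^ n a)"
  define D\<^sub>0 where "D\<^sub>0 = (\<Prod>a\<in>I'. f (Inl a))"
  define N' where "N' = (\<Sum>z\<in>T. \<Prod>w\<in>T - {z}. f (Inr w))"
  define M where "M = (\<Sum>a\<in>I'. smult (of_nat (n a)) (\<Prod>b\<in>I' - {a}. f (Inl b)))"
  have fin: "finite I'"
    using A(1) I' by simp
  have f0: "f i \<noteq> 0" and df: "pderiv (f i) = 1" for i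
    by (simp_all add: f_def pderiv_pCons)
  have nz: "D \<noteq> 0" "D\<^sub>0 \<noteq> 0"
    using fin f0 by (simp_all add: D_def D\<^sub>0_def prod_zero_iff)
  have dN: "pderiv N = N'"
    by (simp add: N_def N'_def pderiv_prod df)
  have dD: "pderiv D * D\<^sub>0 = M * D"
    unfolding D_def D\<^sub>0_def M_def using fin df by (intro pderiv_prod_power) auto
  have minus: "(I' <+> T) - {Inl a} = (I' - {a}) <+> T" "(I' <+> T) - {Inr z} = I' <+> (T - {z})" for a z
    by auto
  have Inl: "of_int (to_int_mod_ring (additive_family H (Inl a :: 'e + 'i))) = (of_nat (n a) :: 'k)" if "a \<in> I'" for a
    using m[OF that] by (simp add: additive_family_def of_int_to_int_of_int[OF char] n_def)
  have Inr: "of_int (to_int_mod_ring (additive_family H (Inr z :: 'e + 'i))) = (- 1 :: 'k)" for z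
    using of_int_to_int_of_int[OF char, of "- 1"] by (simp add: additive_family_def)
  \<comment> \<open>With weight m(a) at the edges and -1 at the added points, \<open>eq\<close>
    gives the numerator of minus the logarithmic derivative of \<open>N / D\<close>.\<close>
  have "[:c:] = (\<Sum>a\<in>I'. smult (of_nat (n a)) ((\<Prod>b\<in>I' - {a}. f (Inl b)) * N)) +
      (\<Sum>z\<in>T. smult (- 1) (D\<^sub>0 * (\<Prod>w\<in>T - {z}. f (Inr w))))"
    unfolding eq[symmetric] I using fin T
    by (simp add: sum.Plus minus prod.Plus Inl Inr N_def D\<^sub>0_def f_def)
  also have "\<dots> = M * N - D\<^sub>0 * N'"
    by (simp add: M_def N'_def sum_distrib_left sum_distrib_right sum_negf)
  finally have MN: "M * N - D\<^sub>0 * N' = [:c:]"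
    by simp
  \<comment> \<open>In the differential of \<open>N / D\<close> the factor \<open>N\<close> cancels,
    leaving a constant over \<open>D * D\<^sub>0\<close>, where each edge has exponent m(a) +
    1.\<close>
  have "(pderiv N * D - N * pderiv D) * D\<^sub>0 = D * (D\<^sub>0 * N') - N * (pderiv D * D\<^sub>0)"
    by (simp add: dN algebra_simps)
  also have "\<dots> = - ((M * N - D\<^sub>0 * N') * D)"
    by (simp only: dD) (simp add: algebra_simps)
  also have "\<dots> = [:- c:] * D"
    unfolding MN by simp
  finally have "(pderiv N * D - N * pderiv D) * D\<^sub>0 * D = [:- c:] * D * D"
    by (rule arg_cong)
  then have "(pderiv N * D - N * pderiv D) * (D * D\<^sub>0) = [:- c:] * (D * D)"
    by (simp only: mult_ac)
  then have form: "fract_deriv (Fract N D) = Fract [:- c:] (D * D\<^sub>0)"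
    using nz by (simp add: fract_deriv_Fract eq_fract)
  have "D * D\<^sub>0 = (\<Prod>a\<in>arcs_from \<Gamma> s - {a\<^sub>0}. [:- x (Inl a), 1:] ^ nat (ht_m H a + 1))"
    unfolding D_def D\<^sub>0_def I'[symmetric] prod.distrib[symmetric]
  proof (rule prod.cong[OF refl])
    fix a
    assume "a \<in> I'"
    then have "nat (ht_m H a + 1) = Suc (n a)"
      using m[of a] by (simp add: n_def nat_add_distrib)
    then show "f (Inl a) ^ n a * f (Inl a) = [:- x (Inl a), 1:] ^ nat (ht_m H a + 1)"
      by (simp only: f_def power_Suc2)
  qed
  moreover have "0 \<le> ht_m H a" if "a \<in> arcs_from \<Gamma> s - {a\<^sub>0}" for a
    using m[of a] that I' by simp
  ultimately have "form_has_divisor (fract_deriv (Fract N D)) (vertex_divisor \<Gamma> H s j)"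
    using form_has_vertex_divisor[OF A sum _ _ j_def, of "- c"] c by (simp add: form)
  moreover have "inj_on j (arcs_from \<Gamma> s)"
    using x by (auto simp: j_def I I' inj_on_def)
  ultimately show ?thesis
    unfolding additive_realizable_def by blast
qed

section \<open>The numerical conditions at a multiplicative and at an additive vertex\<close>

theorem proposition3p18:
  fixes v :: "'K::field_char_0 \<Rightarrow> int"
    and res :: "'K \<Rightarrow> 'k::alg_closed_field"
    and \<Gamma> :: "('v, 'e) serre_graph"
    and H :: "('v, 'e, 'p::prime_card) hurwitz_datum"
    and s :: 'v
    and T :: "'i set"
  assumes "complete_dvr v res"
    and "CHAR('k) = CARD('p)"
    and "\<exists>\<zeta>::'K. primitive_root_of_unity CARD('p) \<zeta>"
    and "hurwitz_tree (v (of_nat CARD('p))) \<Gamma> H"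
    and "s \<in> verts \<Gamma>"
    and "3 \<le> valence \<Gamma> s"
  shows
    "(\<forall>a\<^sub>0 m I.
        multiplicative_vertex (v (of_nat CARD('p))) \<Gamma> H s \<and>
        a\<^sub>0 \<in> arcs_from \<Gamma> s \<and> ht_m H a\<^sub>0 \<noteq> 0 \<and>
        (\<forall>a\<in>arcs_from \<Gamma> s. ht_m H a \<noteq> 0 \<longrightarrow> a = a\<^sub>0) \<and>
        m = - ht_m H a\<^sub>0 \<and> I = arcs_from \<Gamma> s - {a\<^sub>0} \<and>
        (\<exists>P. maximal_adapted_partition I (ht_h H) P \<and>
             int (card P) \<le> \<lfloor>real_of_int m / real CARD('p)\<rfloor> + 1)
        \<longrightarrow> realizable TYPE('k) (v (of_nat CARD('p))) \<Gamma> H s) \<and>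
     (\<forall>a\<^sub>0 m I' I.
        additive_vertex (v (of_nat CARD('p))) \<Gamma> H s \<and>
        a\<^sub>0 \<in> arcs_from \<Gamma> s \<and> ht_m H a\<^sub>0 < 0 \<and>
        (\<forall>a\<in>arcs_from \<Gamma> s. ht_m H a < 0 \<longrightarrow> a = a\<^sub>0) \<and>
        m = - ht_m H a\<^sub>0 \<and> I' = arcs_from \<Gamma> s - {a\<^sub>0} \<and>
        finite T \<and> int (card T) = m + 1 - int (card I') \<and> I = I' <+> T \<and>
        (\<exists>P. maximal_adapted_partition I (additive_family H) P \<and>
             int (card P) \<le> \<lfloor>real_of_int m / real CARD('p)\<rfloor> + 1)
        \<longrightarrow> realizable TYPE('k) (v (of_nat CARD('p))) \<Gamma> H s)"
proof -
  interpret hurwitz_tree "v (of_nat CARD('p))" \<Gamma> H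
    by fact
  note char = \<open>CHAR('k) = CARD('p)\<close>
  let ?A = "arcs_from \<Gamma> s"
  have fin: "finite ?A"
    using tree by (simp add: finite_tree_def arcs_from_def)
  have val: "3 \<le> card ?A"
    using assms(6) by (simp add: valence_def)
  have sum: "(\<Sum>a\<in>?A. ht_m H a + 1) = 2"
    using H3(2) assms(5,6) by simp
  have arc: "a \<in> arcs \<Gamma>" if "a \<in> ?A" for a
    using that by (simp add: arcs_from_def)
  have cop: "coprime (- ht_m H a) (int CARD('p))" if "a \<in> ?A" "ht_m H a \<noteq> 0" for a
    using H2(2)[OF arc] that by simp
  \<comment> \<open>An edge other than \<open>a\<^sub>0\<close> will supply the nonzero weight that
    makes the numerator constant nonzero.\<close>
  have nonempty: "\<exists>a. a \<in> ?A - {a\<^sub>0}" for a\<^sub>0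
  proof (rule ccontr)
    assume "\<nexists>a. a \<in> ?A - {a\<^sub>0}"
    then have "?A \<subseteq> {a\<^sub>0}"
      by blast
    then show False
      using val card_mono[of "{a\<^sub>0}" ?A] by simp
  qed
  show ?thesis
  proof (intro conjI allI impI; elim conjE exE)
    fix a\<^sub>0 m I P
    assume mult: "multiplicative_vertex (v (of_nat CARD('p))) \<Gamma> H s"
      and a\<^sub>0: "a\<^sub>0 \<in> ?A" "ht_m H a\<^sub>0 \<noteq> 0" and uniq: "\<forall>a\<in>?A. ht_m H a \<noteq> 0 \<longrightarrow> a = a\<^sub>0"
      and m: "m = - ht_m H a\<^sub>0" and I: "I = ?A - {a\<^sub>0}"
      and P: "maximal_adapted_partition I (ht_h H) P" "int (card P) \<le> \<lfloor>real_of_int m / real CARD('p)\<rfloor> + 1"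
    have m0: "ht_m H a = 0" if "a \<in> I" for a
      using uniq that I by blast
    \<comment> \<open>Every edge of \<open>I\<close> contributes 1 to the sum in \<open>H3\<close>,
      so that sum determines \<open>card I\<close>; valence at least 3 then makes \<open>m\<close>
      positive.\<close>
    have "(\<Sum>a\<in>?A. ht_m H a + 1) = (ht_m H a\<^sub>0 + 1) + (\<Sum>a\<in>I. ht_m H a + 1)"
      unfolding I using fin a\<^sub>0(1) by (rule sum.remove)
    also have "(\<Sum>a\<in>I. ht_m H a + 1) = int (card I)"
      using m0 by simp
    finally have cardI: "int (card I) = m + 1"
      using sum m by simp
    moreover have "card ?A = card I + 1"
      unfolding I using fin a\<^sub>0(1) val by (simp add: card_Diff_singleton)
    ultimately have mpos: "0 < m"
      using val by simp
    have finI: "finite I"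
      using fin I by simp
    have cop_m: "coprime m (int CARD('p))"
      unfolding m using a\<^sub>0 by (rule cop)
    obtain i where i: "i \<in> I"
      using nonempty I by blast
    have hi: "ht_h H i \<noteq> 0"
      using H2(1)[OF arc, of i] m0[OF i] i I by simp
    obtain x :: "'e \<Rightarrow> 'k" and c where x: "inj_on x I" "c \<noteq> 0"
      "(\<Sum>i\<in>I. smult (of_int (to_int_mod_ring (ht_h H i))) (\<Prod>j\<in>I - {i}. [:- x j, 1:])) = [:c:]"
      using adapted_partition_distinct_points[OF char finI cardI mpos cop_m P i hi] by blast
    have "ht_h H a\<^sub>0 = 0"
      using H2(1)[OF arc[OF a\<^sub>0(1)]] a\<^sub>0(2) by simp
    moreover have "ht_m H a\<^sub>0 < 0"
      using mpos m by simp
    ultimately have "multiplicative_realizable TYPE('k) \<Gamma> H s"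
      using m0 x by (intro multiplicative_realizableI[OF fin a\<^sub>0(1) I sum])
    then show "realizable TYPE('k) (v (of_nat CARD('p))) \<Gamma> H s"
      using mult by (simp add: realizable_def)
  next
    fix a\<^sub>0 m I' I P
    assume add: "additive_vertex (v (of_nat CARD('p))) \<Gamma> H s"
      and a\<^sub>0: "a\<^sub>0 \<in> ?A" "ht_m H a\<^sub>0 < 0" and uniq: "\<forall>a\<in>?A. ht_m H a < 0 \<longrightarrow> a = a\<^sub>0"
      and m: "m = - ht_m H a\<^sub>0" and I': "I' = ?A - {a\<^sub>0}"
      and T: "finite T" "int (card T) = m + 1 - int (card I')" and I: "I = I' <+> T"
      and P: "maximal_adapted_partition I (additive_family H) P"
        "int (card P) \<le> \<lfloor>real_of_int m / real CARD('p)\<rfloor> + 1"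
    \<comment> \<open>At an additive vertex \<open>H7\<close> makes \<open>h\<close> zero, hence
      \<open>m\<close> is nonzero on every edge by \<open>H2\<close>; all edges but
      \<open>a\<^sub>0\<close> then have positive \<open>m\<close>.\<close>
    have nz: "ht_m H a \<noteq> 0" if "a \<in> ?A" for a
      using H2(1)[OF arc[OF that]] H7[OF assms(5) _ that] add by simp
    have pos: "0 < ht_m H a" if "a \<in> I'" for a
      using uniq nz[of a] that I' by force
    have finI': "finite I'"
      using fin I' by simp
    then have finI: "finite I" and cardI: "int (card I) = m + 1"
      using T I by (simp_all add: card_Plus)
    have mpos: "0 < m"
      using a\<^sub>0(2) m by simp
    have cop_m: "coprime m (int CARD('p))"
      unfolding m using a\<^sub>0(1) nz[OF a\<^sub>0(1)] by (rule cop)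
    obtain a where a: "a \<in> I'"
      using nonempty I' by blast
    then have aI: "Inl a \<in> I"
      using I by blast
    \<comment> \<open>\<open>ht_m H a\<close> is prime to the characteristic, so its class is a
      nonzero weight.\<close>
    have "(of_int (ht_m H a) :: 'k) \<noteq> 0"
    proof
      assume "(of_int (ht_m H a) :: 'k) = 0"
      then have "int CARD('p) dvd ht_m H a"
        by (simp add: of_int_eq_0_iff_char_dvd char)
      then have "is_unit (int CARD('p))"
        using coprime_common_divisor[OF cop[of a], of "int CARD('p)"] nz[of a] a I' by auto
      then show False
        using prime_gt_1_nat[OF prime_card[where 'a = 'p]] by simp
    qed
    then have ea: "(additive_family H :: 'e + 'i \<Rightarrow> 'p mod_ring) (Inl a) \<noteq> 0"
      using of_int_to_int_eq_0_iff[OF char, of "of_int (ht_m H a)"]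
      by (simp add: additive_family_def of_int_to_int_of_int[OF char])
    obtain x :: "'e + 'i \<Rightarrow> 'k" and c where x: "inj_on x I" "c \<noteq> 0"
      "(\<Sum>i\<in>I. smult (of_int (to_int_mod_ring (additive_family H i))) (\<Prod>j\<in>I - {i}. [:- x j, 1:])) = [:c:]"
      using adapted_partition_distinct_points[OF char finI cardI mpos cop_m P aI ea] by blast
    then have "additive_realizable TYPE('k) \<Gamma> H s"
      using pos by (intro additive_realizableI[OF char fin a\<^sub>0(1) I' T(1) I sum])
    then show "realizable TYPE('k) (v (of_nat CARD('p))) \<Gamma> H s"
      using add by (simp add: realizable_def)
  qed
qed

end
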